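(* Let $W$ be a vector space over $\mathbb{C}$, let $r$ be a positive integer, and let $V$ be a closed local subspace of $\mathcal{E}(W,r)$ containing $1_W$. Then $(V,Y_{\mathcal E},1_W)$ carries the structure of an $(r+1)$-toroidal vertex algebra and $W$ is a faithful $V$-module with $Y_W(a(x_0,\mathbf x);z_0,\mathbf z)=a(z_0,\mathbf z)$ for $a(x_0,\mathbf x)\in V$. Furthermore, if $V$ is also stable under $D_i$ $(i=0,1,\dots,r)$, then $V$ is an extended $(r+1)$-toroidal vertex algebra with $\mathcal D_i=D_i$ $(i=0,1,\dots,r)$.
   Context: Scalars are $\mathbb{C}$. All variables are mutually commuting formal variables. $\mathbf{x}=(x_1,\dots,x_r)$, $\mathbf{x}^{\mathbf m}=x_1^{m_1}\cdots x_r^{m_r}$ for $\mathbf m\in\mathbb{Z}^r$, $\mathbf{z}\mathbf{y}=(z_1y_1,\dots,z_ry_r)$. $\delta(x)=\sum_{n\in\mathbb{Z}}x^n$, and powers of binomials such as $(x_0-y_0)^n$ are expanded in nonnegative powers of the second variable. $V[[x_1^{\pm1},\dots,x_r^{\pm1}]]((x_0))$ is the space of Laurent series in $x_0$ (finitely many negative powers) with coefficients in $V[[x_1^{\pm1},\dots,x_r^{\pm1}]]$; $((x_0,y_0))$ means only finitely many negative powers of $x_0$ and of $y_0$. An $(r+1)$-toroidal vertex algebra is a vector space $V$ with a linear map $Y(\cdot;x_0,\mathbf{x}):V\to \mathrm{Hom}(V,V[[x_1^{\pm1},\dots,x_r^{\pm1}]]((x_0)))$, $Y(v;x_0,\mathbf{x})=\sum_{(m_0,\mathbf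 m)\in\mathbb{Z}\times\mathbb{Z}^r}v_{m_0,\mathbf m}x_0^{-m_0-1}\mathbf{x}^{-\mathbf m}$, and a vector $\mathbf 1\in V$ (vacuum) such that $Y(\mathbf 1;x_0,\mathbf{x})v=v$ and $Y(v;x_0,\mathbf{x})\mathbf 1\in V[[x_0,x_1^{\pm1},\dots,x_r^{\pm1}]]$ for $v\in V$, and for $u,v\in V$ (Jacobi identity) $$z_0^{-1}\delta\Big(\frac{x_0-y_0}{z_0}\Big)Y(u;x_0,\mathbf{z}\mathbf{y})Y(v;y_0,\mathbf{y})-z_0^{-1}\delta\Big(\frac{y_0-x_0}{-z_0}\Big)Y(v;y_0,\mathbf{y})Y(u;x_0,\mathbf{z}\mathbf{y})=y_0^{-1}\delta\Big(\frac{x_0-z_0}{y_0}\Big)Y(Y(u;z_0,\mathbf{z})v;y_0,\mathbf{y}).$$ An extended $(r+1)$-toroidal vertex algebra is one equipped with linear operators $\mathcal D_0,\dots,\mathcal D_r$ such that $\mathcal D_i\mathbf 1=0$, $[\mathcal D_0,Y(v;x_0,\mathbf x)]=Y(\mathcal D_0v;x_0,\mathbf x)=\frac{\partial}{\partial x_0}Y(v;x_0,\mathbf x)$ and $[\mathcal D_j,Y(v;x_0,\mathbf x)]=Y(\mathcal D_jv;x_0,\mathbf x)=x_j\frac{\partial}{\partial x_j}Y(v;x_0,\mathbf x)$ for $v\in V$, $1\le j\le r$. A module for an $(r+1)$-toroidal vertex algebra $V$ is a vector space $W$ with a linear map $Y_W:V\to\mathrm{Hom}(W,W[[x_1^{\pm1},\dots,x_r^{\pm1}]]((x_0)))$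 with $Y_W(\mathbf 1;x_0,\mathbf x)=1_W$ and satisfying the Jacobi identity with $Y$ replaced by $Y_W$ (except for the inner $Y(u;z_0,\mathbf z)v$). It is faithful if $Y_W$ is injective. $\mathcal{E}(W,r)=\mathrm{Hom}(W,W[[x_1^{\pm1},\dots,x_r^{\pm1}]]((x_0)))$. Elements $a,b\in\mathcal{E}(W,r)$ are mutually local if $(x_0-y_0)^k a(x_0,\mathbf x)b(y_0,\mathbf y)=(x_0-y_0)^kb(y_0,\mathbf y)a(x_0,\mathbf x)$ for some nonnegative integer $k$. A subset is local if any two of its elements (possibly equal) are mutually local. If $a,b$ are mutually local (or more generally if the pair $(a,b)$ is compatible: $(x_0-y_0)^ka(x_0,\mathbf x)b(y_0,\mathbf y)\in\mathrm{Hom}(W,W[[x_1^{\pm1},y_1^{\pm1},\dots,x_r^{\pm1},y_r^{\pm1}]]((x_0,y_0)))$ for some nonnegative integer $k$), the elements $a(x_0,\mathbf x)_{m_0,\mathbf m}b(x_0,\mathbf x)\in\mathcal E(W,r)$ are defined by $$Y_{\mathcal E}(a(y_0,\mathbf y);z_0,\mathbf z)b(y_0,\mathbf y)=\sum_{(m_0,\mathbf m)\in\mathbb Z\times\mathbb Z^r}a(y_0,\mathbf y)_{m_0,\mathbf m}b(y_0,\mathbf y)\,z_0^{-m_0-1}\mathbf z^{-\mathbf m}=z_0^{-k}\big((x_0-y_0)^ka(x_0,\mathbf z\mathbf y)b(y_0,\mathbf y)\big)\big|_{x_0=y_0+z_0},$$ with $k$ any integer as in the compatibility condition (independent of $k$).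 A local subspace $V$ of $\mathcal E(W,r)$ is closed if $a_{m_0,\mathbf m}b\in V$ for all $a,b\in V$, $(m_0,\mathbf m)\in\mathbb Z\times\mathbb Z^r$. On $\mathcal E(W,r)$, $D_0=\frac{\partial}{\partial x_0}$ and $D_i=x_i\frac{\partial}{\partial x_i}$ for $1\le i\le r$. *)

theory Defs
  imports
    "HOL-Analysis.Finite_Cartesian_Product"
    "HOL-Library.Function_Algebras"
begin

(* A formal series is the function sending an exponent to the coefficient of the corresponding
   monomial.  The pair (n, m) stands for x_0^n x^m, so that the mode v_{m_0,m} of a series is its
   coefficient at (-m_0 - 1, -m).  The number r of variables x_1, ..., x_r is CARD('r), which
   is positive since types are nonempty. *)

type_synonym ('r, 'a) series = "int \<times> (int ^ 'r) \<Rightarrow> 'a"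

type_synonym ('r, 'w) opseries = "'w \<Rightarrow> ('r, 'w) series"

definition mode :: "('r::finite, 'a) series \<Rightarrow> int \<Rightarrow> int ^ 'r \<Rightarrow> 'a" where
  "mode f m0 m = f (- m0 - 1, - m)"

definition const_series :: "'a::zero \<Rightarrow> ('r::finite, 'a) series" where
  "const_series v = (\<lambda>(n, m). if n = 0 \<and> m = 0 then v else 0)"

definition pointwise :: "('c \<Rightarrow> 'a \<Rightarrow> 'a) \<Rightarrow> 'c \<Rightarrow> ('k \<Rightarrow> 'a) \<Rightarrow> 'k \<Rightarrow> 'a" where
  "pointwise s c f = (\<lambda>k. s c (f k))"

definition Hom_on :: "('c \<Rightarrow> 'a::ab_group_add \<Rightarrow> 'a) \<Rightarrow> 'a set \<Rightarrow>
    ('c \<Rightarrow> 'b::ab_group_add \<Rightarrow> 'b) \<Rightarrow> 'b set \<Rightarrow> ('a \<Rightarrow> 'b) set" where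
  "Hom_on s S t T = {f. (\<forall>u\<in>S. f u \<in> T) \<and>
     (\<forall>u\<in>S. \<forall>v\<in>S. f (u + v) = f u + f v) \<and>
     (\<forall>c. \<forall>u\<in>S. f (s c u) = t c (f u))}"

text \<open>\<open>W[[x\<^sub>1\<^sup>\<plusminus>,\<dots>,x\<^sub>r\<^sup>\<plusminus>]]((x\<^sub>0))\<close>: the bound on the powers of \<open>x\<^sub>0\<close> is uniform in the other exponents.\<close>

definition laurent :: "'a::zero set \<Rightarrow> ('r::finite, 'a) series set" where
  "laurent W = {f. (\<forall>k. f k \<in> W) \<and> (\<exists>N. \<forall>n m. n < N \<longrightarrow> f (n, m) = 0)}"

definition taylor :: "'a::zero set \<Rightarrow> ('r::finite, 'a) series set" where
  "taylor W = {f. (\<forall>k. f k \<in> W) \<and> (\<forall>n m. n < 0 \<longrightarrow> f (n, m) = 0)}"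

definition d_x0 :: "(complex \<Rightarrow> 'a \<Rightarrow> 'a) \<Rightarrow> ('r::finite, 'a) series \<Rightarrow> ('r, 'a) series" where
  "d_x0 s f = (\<lambda>(n, m). s (of_int (n + 1)) (f (n + 1, m)))"

definition x_d_x :: "(complex \<Rightarrow> 'a \<Rightarrow> 'a) \<Rightarrow> 'r \<Rightarrow> ('r::finite, 'a) series \<Rightarrow> ('r, 'a) series" where
  "x_d_x s i f = (\<lambda>(n, m). s (of_int (m $ i)) (f (n, m)))"

text \<open>The coefficient of \<open>x\<^sup>a y\<^sup>b\<close> in \<open>(x + e y)\<^sup>n\<close>, expanded in nonnegative powers of \<open>y\<close>.\<close>

definition binom_coeff :: "complex \<Rightarrow> int \<Rightarrow> int \<Rightarrow> int \<Rightarrow> complex" where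
  "binom_coeff e n a b =
     (if b \<ge> 0 \<and> a + b = n then e ^ nat b * (of_int n gchoose nat b) else 0)"

text \<open>The coefficient of \<open>x\<^sup>a y\<^sup>b t\<^sup>c\<close> in \<open>t\<^sup>-\<^sup>1 \<delta>((x - y) / (e t))\<close>, that is, in the sum over \<open>n\<close> of
  \<open>e\<^sup>-\<^sup>n t\<^sup>-\<^sup>n\<^sup>-\<^sup>1 (x - y)\<^sup>n\<close>.  Below \<open>e\<close> is \<open>1\<close> or \<open>-1\<close>.\<close>

definition delta_coeff :: "complex \<Rightarrow> int \<Rightarrow> int \<Rightarrow> int \<Rightarrow> complex" where
  "delta_coeff e a b c = e powi (c + 1) * binom_coeff (- 1) (- c - 1) a b"

text \<open>The product of a scalar series and a vector-valued series.  It is only used where each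
  coefficient of the product receives finitely many nonzero contributions.\<close>

definition series_mult :: "(complex \<Rightarrow> 'a \<Rightarrow> 'a) \<Rightarrow> ('k::ab_group_add \<Rightarrow> complex) \<Rightarrow>
    ('k \<Rightarrow> 'a::ab_group_add) \<Rightarrow> 'k \<Rightarrow> 'a" where
  "series_mult s f g k = (\<Sum>j | f j \<noteq> 0 \<and> g (k - j) \<noteq> 0. s (f j) (g (k - j)))"

text \<open>Linear maps \<open>Y\<close> from \<open>V\<close> to \<open>Hom(W, W[[x\<^sub>1\<^sup>\<plusminus>,\<dots>,x\<^sub>r\<^sup>\<plusminus>]]((x\<^sub>0)))\<close>.  Values of \<open>Y u\<close> outside the
  carrier \<open>W\<close> are irrelevant, hence linearity in \<open>u\<close> is only required at each \<open>w \<in> W\<close>.\<close>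

definition vertex_map :: "(complex \<Rightarrow> 'v \<Rightarrow> 'v) \<Rightarrow> 'v::ab_group_add set \<Rightarrow>
    (complex \<Rightarrow> 'w \<Rightarrow> 'w) \<Rightarrow> 'w::ab_group_add set \<Rightarrow> ('v \<Rightarrow> ('r::finite, 'w) opseries) \<Rightarrow> bool" where
  "vertex_map sV V sW W Y \<longleftrightarrow>
     (\<forall>u\<in>V. Y u \<in> Hom_on sW W (pointwise sW) (laurent W)) \<and>
     (\<forall>w\<in>W. (\<lambda>u. Y u w) \<in> Hom_on sV V (pointwise sW) (laurent W))"

text \<open>The Jacobi identity, applied to \<open>w \<in> W\<close>.  The exponent \<open>(a, b, c, p, q)\<close> stands for
  \<open>x\<^sub>0\<^sup>a y\<^sub>0\<^sup>b z\<^sub>0\<^sup>c z\<^sup>p y\<^sup>q\<close>.  Under the substitution \<open>x = z y\<close> the monomial \<open>x\<^sup>m y\<^sup>n\<close> becomes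
  \<open>z\<^sup>m y\<^sup>m\<^sup>+\<^sup>n\<close>, so that \<open>m = p\<close> and \<open>n = q - p\<close>.\<close>

definition jacobi :: "'v set \<Rightarrow> ('v \<Rightarrow> ('r::finite, 'v) opseries) \<Rightarrow>
    (complex \<Rightarrow> 'w \<Rightarrow> 'w) \<Rightarrow> 'w::ab_group_add set \<Rightarrow> ('v \<Rightarrow> ('r, 'w) opseries) \<Rightarrow> bool" where
  "jacobi V Y sW W YW \<longleftrightarrow> (\<forall>u\<in>V. \<forall>v\<in>V. \<forall>w\<in>W.
     series_mult sW
       (\<lambda>(a, b, c, p, q). if p = 0 \<and> q = 0 then delta_coeff 1 a b c else 0)
       (\<lambda>(a, b, c, p, q). if c = 0 then YW u (YW v w (b, q - p)) (a, p) else 0)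
   - series_mult sW
       (\<lambda>(a, b, c, p, q). if p = 0 \<and> q = 0 then delta_coeff (- 1) b a c else 0)
       (\<lambda>(a, b, c, p, q). if c = 0 then YW v (YW u w (a, p)) (b, q - p) else 0)
   = series_mult sW
       (\<lambda>(a, b, c, p, q). if p = 0 \<and> q = 0 then delta_coeff 1 a c b else 0)
       (\<lambda>(a, b, c, p, q). if a = 0 then YW (Y u v (c, p)) w (b, q) else 0))"

text \<open>The underlying vector space of the algebra is a subspace \<open>V\<close> of an ambient type.\<close>

locale toroidal_vertex_algebra = vector_space scale
  for scale :: "complex \<Rightarrow> 'v::ab_group_add \<Rightarrow> 'v" +
  fixes V :: "'v set" and Y :: "'v \<Rightarrow> ('r::finite, 'v) opseries" and vac :: 'v
  assumes subspace_V: "subspace V"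
    and vac_in: "vac \<in> V"
    and Y_map: "vertex_map scale V scale V Y"
    and vac_left: "v \<in> V \<Longrightarrow> Y vac v = const_series v"
    and creation: "v \<in> V \<Longrightarrow> Y v vac \<in> taylor V"
    and jacobi_V: "jacobi V Y scale V Y"

locale extended_toroidal_vertex_algebra = toroidal_vertex_algebra scale V Y vac
  for scale :: "complex \<Rightarrow> 'v::ab_group_add \<Rightarrow> 'v"
    and V :: "'v set" and Y :: "'v \<Rightarrow> ('r::finite, 'v) opseries" and vac :: 'v +
  fixes D0 :: "'v \<Rightarrow> 'v" and D :: "'r \<Rightarrow> 'v \<Rightarrow> 'v"
  assumes D0_linear: "D0 \<in> Hom_on scale V scale V"
    and D_linear: "D i \<in> Hom_on scale V scale V"
    and D0_vac: "D0 vac = 0"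
    and D_vac: "D i vac = 0"
    and D0_comm: "\<lbrakk>v \<in> V; w \<in> V\<rbrakk> \<Longrightarrow> (\<lambda>k. D0 (Y v w k)) - Y v (D0 w) = Y (D0 v) w"
    and D0_deriv: "\<lbrakk>v \<in> V; w \<in> V\<rbrakk> \<Longrightarrow> Y (D0 v) w = d_x0 scale (Y v w)"
    and D_comm: "\<lbrakk>v \<in> V; w \<in> V\<rbrakk> \<Longrightarrow> (\<lambda>k. D i (Y v w k)) - Y v (D i w) = Y (D i v) w"
    and D_deriv: "\<lbrakk>v \<in> V; w \<in> V\<rbrakk> \<Longrightarrow> Y (D i v) w = x_d_x scale i (Y v w)"

locale toroidal_module =
  toroidal_vertex_algebra scale V Y vac + module_space: vector_space scaleW
  for scale :: "complex \<Rightarrow> 'v::ab_group_add \<Rightarrow> 'v"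
    and V :: "'v set" and Y :: "'v \<Rightarrow> ('r::finite, 'v) opseries" and vac :: 'v
    and scaleW :: "complex \<Rightarrow> 'w::ab_group_add \<Rightarrow> 'w" +
  fixes W :: "'w set" and YW :: "'v \<Rightarrow> ('r, 'w) opseries"
  assumes subspace_W: "module_space.subspace W"
    and YW_map: "vertex_map scale V scaleW W YW"
    and YW_vac: "w \<in> W \<Longrightarrow> YW vac w = const_series w"
    and jacobi_W: "jacobi V Y scaleW W YW"

locale faithful_toroidal_module = toroidal_module scale V Y vac scaleW W YW
  for scale :: "complex \<Rightarrow> 'v::ab_group_add \<Rightarrow> 'v"
    and V :: "'v set" and Y :: "'v \<Rightarrow> ('r::finite, 'v) opseries" and vac :: 'v
    and scaleW :: "complex \<Rightarrow> 'w::ab_group_add \<Rightarrow> 'w"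
    and W :: "'w set" and YW :: "'v \<Rightarrow> ('r, 'w) opseries" +
  assumes faithful: "inj_on (\<lambda>v. restrict (YW v) W) V"

text \<open>The space \<open>\<E>(W,r)\<close>, for the vector space \<open>W\<close> given by the type \<open>'w\<close> and \<open>s\<close>.\<close>

definition E_space :: "(complex \<Rightarrow> 'w::ab_group_add \<Rightarrow> 'w) \<Rightarrow> ('r::finite, 'w) opseries set" where
  "E_space s = Hom_on s UNIV (pointwise s) (laurent UNIV)"

definition E_scale :: "(complex \<Rightarrow> 'w \<Rightarrow> 'w) \<Rightarrow> complex \<Rightarrow>
    ('r::finite, 'w) opseries \<Rightarrow> ('r, 'w) opseries" where
  "E_scale s = pointwise (pointwise s)"

text \<open>In what follows, the exponent \<open>(i, j, m, n)\<close> stands for \<open>x\<^sub>0\<^sup>i y\<^sub>0\<^sup>j x\<^sup>m y\<^sup>n\<close>.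
  The next function is multiplication by \<open>(x\<^sub>0 - y\<^sub>0)\<^sup>k\<close>.\<close>

definition diff_power_mult :: "(complex \<Rightarrow> 'w \<Rightarrow> 'w) \<Rightarrow> nat \<Rightarrow>
    (int \<times> int \<times> (int ^ 'r) \<times> (int ^ 'r) \<Rightarrow> 'w::ab_group_add) \<Rightarrow>
    int \<times> int \<times> (int ^ 'r::finite) \<times> (int ^ 'r) \<Rightarrow> 'w" where
  "diff_power_mult s k =
     series_mult s (\<lambda>(i, j, m, n). if m = 0 \<and> n = 0 then binom_coeff (- 1) (int k) i j else 0)"

text \<open>\<open>a(x\<^sub>0,x) b(y\<^sub>0,y) w\<close> and \<open>b(y\<^sub>0,y) a(x\<^sub>0,x) w\<close>\<close>

definition prod_xy :: "('r::finite, 'w) opseries \<Rightarrow> ('r, 'w) opseries \<Rightarrow> 'w \<Rightarrow>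
    int \<times> int \<times> (int ^ 'r) \<times> (int ^ 'r) \<Rightarrow> 'w" where
  "prod_xy a b w = (\<lambda>(i, j, m, n). a (b w (j, n)) (i, m))"

definition prod_yx :: "('r::finite, 'w) opseries \<Rightarrow> ('r, 'w) opseries \<Rightarrow> 'w \<Rightarrow>
    int \<times> int \<times> (int ^ 'r) \<times> (int ^ 'r) \<Rightarrow> 'w" where
  "prod_yx a b w = (\<lambda>(i, j, m, n). b (a w (i, m)) (j, n))"

definition mutually_local :: "(complex \<Rightarrow> 'w::ab_group_add \<Rightarrow> 'w) \<Rightarrow>
    ('r::finite, 'w) opseries \<Rightarrow> ('r, 'w) opseries \<Rightarrow> bool" where
  "mutually_local s a b \<longleftrightarrow>
     (\<exists>k. \<forall>w. diff_power_mult s k (prod_xy a b w) = diff_power_mult s k (prod_yx a b w))"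

definition local_set :: "(complex \<Rightarrow> 'w::ab_group_add \<Rightarrow> 'w) \<Rightarrow>
    ('r::finite, 'w) opseries set \<Rightarrow> bool" where
  "local_set s S \<longleftrightarrow> (\<forall>a\<in>S. \<forall>b\<in>S. mutually_local s a b)"

text \<open>\<open>W[[x\<^sub>1\<^sup>\<plusminus>,y\<^sub>1\<^sup>\<plusminus>,\<dots>,x\<^sub>r\<^sup>\<plusminus>,y\<^sub>r\<^sup>\<plusminus>]]((x\<^sub>0,y\<^sub>0))\<close>\<close>

definition laurent2 :: "(int \<times> int \<times> (int ^ 'r::finite) \<times> (int ^ 'r) \<Rightarrow> 'w::zero) set" where
  "laurent2 = {f. \<exists>N. \<forall>i j m n. i < N \<or> j < N \<longrightarrow> f (i, j, m, n) = 0}"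

definition compatible_order :: "(complex \<Rightarrow> 'w::ab_group_add \<Rightarrow> 'w) \<Rightarrow>
    ('r::finite, 'w) opseries \<Rightarrow> ('r, 'w) opseries \<Rightarrow> nat \<Rightarrow> bool" where
  "compatible_order s a b k \<longleftrightarrow>
     (\<lambda>w. diff_power_mult s k (prod_xy a b w)) \<in> Hom_on s UNIV (pointwise s) laurent2"

text \<open>The coefficient of \<open>y\<^sub>0\<^sup>d z\<^sub>0\<^sup>e\<close> in \<open>G(x\<^sub>0,y\<^sub>0)\<close> at \<open>x\<^sub>0 = y\<^sub>0 + z\<^sub>0\<close>; the sum is finite if the powers
  of \<open>x\<^sub>0\<close> and of \<open>y\<^sub>0\<close> in \<open>G\<close> are bounded below.\<close>

definition subst_coeff :: "(complex \<Rightarrow> 'w \<Rightarrow> 'w) \<Rightarrow> (int \<Rightarrow> int \<Rightarrow> 'w::ab_group_add) \<Rightarrow>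
    int \<Rightarrow> int \<Rightarrow> 'w" where
  "subst_coeff s G d e = (\<Sum>(i, j) | binom_coeff 1 i (d - j) e \<noteq> 0 \<and> G i j \<noteq> 0.
     s (binom_coeff 1 i (d - j) e) (G i j))"

text \<open>The value at \<open>w\<close> of \<open>z\<^sub>0\<^sup>-\<^sup>k ((x\<^sub>0 - y\<^sub>0)\<^sup>k a(x\<^sub>0,zy) b(y\<^sub>0,y))\<close> at \<open>x\<^sub>0 = y\<^sub>0 + z\<^sub>0\<close>; the coefficient of
  \<open>z\<^sub>0\<^sup>c z\<^sup>p\<close> is a series in \<open>y\<^sub>0\<close>, \<open>y\<close>, with exponents \<open>d\<close>, \<open>q\<close>.\<close>

definition Y_E_order :: "(complex \<Rightarrow> 'w::ab_group_add \<Rightarrow> 'w) \<Rightarrow> nat \<Rightarrow>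
    ('r::finite, 'w) opseries \<Rightarrow> ('r, 'w) opseries \<Rightarrow> ('r, ('r, 'w) opseries) series" where
  "Y_E_order s k a b = (\<lambda>(c, p). \<lambda>w. \<lambda>(d, q).
     subst_coeff s (\<lambda>i j. diff_power_mult s k (prod_xy a b w) (i, j, p, q - p)) d (c + int k))"

definition Y_E :: "(complex \<Rightarrow> 'w::ab_group_add \<Rightarrow> 'w) \<Rightarrow>
    ('r::finite, 'w) opseries \<Rightarrow> ('r, ('r, 'w) opseries) opseries" where
  "Y_E s a b = Y_E_order s (SOME k. compatible_order s a b k) a b"

definition closed_set :: "(complex \<Rightarrow> 'w::ab_group_add \<Rightarrow> 'w) \<Rightarrow>
    ('r::finite, 'w) opseries set \<Rightarrow> bool" where
  "closed_set s S \<longleftrightarrow> (\<forall>a\<in>S. \<forall>b\<in>S. \<forall>m0 m. mode (Y_E s a b) m0 m \<in> S)"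

definition E_D0 :: "(complex \<Rightarrow> 'w \<Rightarrow> 'w) \<Rightarrow> ('r::finite, 'w) opseries \<Rightarrow> ('r, 'w) opseries" where
  "E_D0 s a = (\<lambda>w. d_x0 s (a w))"

definition E_D :: "(complex \<Rightarrow> 'w \<Rightarrow> 'w) \<Rightarrow> 'r \<Rightarrow>
    ('r::finite, 'w) opseries \<Rightarrow> ('r, 'w) opseries" where
  "E_D s i a = (\<lambda>w. x_d_x s i (a w))"

end

theory Submission
  imports Defs "HOL-Library.Groups_Big_Fun" "HOL-Computational_Algebra.Formal_Power_Series"
begin

text \<open>
  An element \<open>a\<close> of \<open>\<E>(W,r)\<close> is a family of formal fields \<open>a\<^sup>p(x\<^sub>0)\<close> in one variable, one for each
  exponent \<open>p\<close> of \<open>x\<close>.  The substitution \<open>x = z y\<close> only adds exponents, so the component of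
  \<open>Y\<^sub>\<E>(a; z\<^sub>0, z) b\<close> at \<open>z\<^sup>p y\<^sup>q\<close> involves nothing but \<open>a\<^sup>p\<close> and \<open>b\<^sup>q\<^sup>-\<^sup>p\<close>, and it turns out to consist
  of the classical products \<open>a\<^sup>p\<^sub>(\<^sub>n\<^sub>) b\<^sup>q\<^sup>-\<^sup>p\<close> of local fields (\<open>component_Y_E\<close>).  The toroidal Jacobi
  identities are therefore Borcherds identities for the products of fields in one variable, and the
  other axioms are identities between such products.

  The product is taken in its residue form
  \<open>a\<^sub>(\<^sub>n\<^sub>) b (y) = Res\<^sub>x ((x - y)\<^sup>n a(x) b(y) - (- y + x)\<^sup>n b(y) a(x))\<close>, which makes sense for all fields
  and all integers \<open>n\<close>.  It agrees with the definition by the substitution \<open>x\<^sub>0 = y\<^sub>0 + z\<^sub>0\<close>: after a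
  factor \<open>(x - y)\<^sup>k\<close> is moved from the binomial to the fields, both products \<open>a(x) b(y)\<close> and
  \<open>b(y) a(x)\<close> become one and the same series with bounded powers of \<open>x\<close> and \<open>y\<close>, and for a monomial
  the equality is a binomial identity (\<open>residue_substitution\<close>).

  Both sides of a Borcherds identity, as functions of its three integer parameters, obey the
  recursion that comes from \<open>x = y + (x - y)\<close>.  Their difference \<open>D\<close> then satisfies
  \<open>D (m + 1) n k = D m n (k + 1) + D m (n + 1) k\<close>, and such a function vanishes as soon as it vanishes
  for all large \<open>n\<close> and for all large \<open>m\<close> (\<open>pascal_recursion_zero\<close>).  Two special cases remain each time.

  On \<open>W\<close>, the case of large \<open>n\<close> is locality, and for \<open>m = 0\<close> the identity is the definition
  of the product; the recursion carries it to all \<open>m \<ge> 0\<close> (\<open>borcherds_identity\<close>).  On \<open>V\<close>, the two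
  cases are weak commutativity and weak associativity.  Weak commutativity holds because in
  \<open>a\<^sub>(\<^sub>m\<^sub>) (b\<^sub>(\<^sub>k\<^sub>) c) - b\<^sub>(\<^sub>k\<^sub>) (a\<^sub>(\<^sub>m\<^sub>) c)\<close> the terms with \<open>c\<close> between \<open>a\<close> and \<open>b\<close> cancel, which leaves only
  the commutator of \<open>a\<close> and \<open>b\<close> (\<open>weak_commutativity\<close>).  Weak associativity
  follows from the weak commutativity of \<open>a\<close> and \<open>c\<close> acting on \<open>b\<close>, by the skew symmetry
  \<open>b\<^sub>(\<^sub>k\<^sub>) c = \<Sum>\<^sub>i (- 1)\<^sup>k\<^sup>+\<^sup>1\<^sup>+\<^sup>i \<partial>\<^sup>i / i! (c\<^sub>(\<^sub>k\<^sub>+\<^sub>i\<^sub>) b)\<close> (\<open>weak_associativity\<close>), and skew symmetry is itself a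
  case of the identity on \<open>W\<close>.  Closedness of \<open>V\<close> supplies the locality of
  \<open>a\<^sub>(\<^sub>n\<^sub>) b\<close> and \<open>c\<close> that this argument uses.
\<close>

section \<open>Arrays of coefficients and multiplication by powers of \<open>x - y\<close>\<close>

lemma Sum_any_lessThan:
  fixes f :: "nat \<Rightarrow> 'a::comm_monoid_add"
  assumes "\<And>j. B \<le> j \<Longrightarrow> f j = 0"
  shows "Sum_any f = sum f {..<B}"
  by (rule Sum_any.expand_superset) (use assms not_less in auto)

text \<open>The coefficient of \<open>x\<^sup>n\<^sup>-\<^sup>j y\<^sup>j\<close> in \<open>(x - y)\<^sup>n\<close>, expanded in nonnegative powers of \<open>y\<close>.\<close>

definition alt_binomial :: "int \<Rightarrow> nat \<Rightarrow> 'k::field_char_0" where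
  "alt_binomial n j = (- 1) ^ j * (of_int n gchoose j)"

lemma alt_binomial_0 [simp]: "alt_binomial n 0 = 1"
  by (simp add: alt_binomial_def)

lemma alt_binomial_zero: "alt_binomial 0 j = (if j = 0 then 1 else 0)"
  by (auto simp: alt_binomial_def gbinomial_0_left)

lemma alt_binomial_Suc:
  "(alt_binomial (n + 1) (Suc j) :: 'k::field_char_0) = alt_binomial n (Suc j) - alt_binomial n j"
  by (simp add: alt_binomial_def gbinomial_Suc_Suc distrib_left)

lemmas alt_binomial_Suc' = alt_binomial_Suc[unfolded add.commute[of _ 1]]

lemma gbinomial_Suc_Suc': "(1 + a) gchoose Suc j = (a gchoose j) + (a gchoose Suc j)"
  for a :: "'k::field_char_0"
  by (subst add.commute) (rule gbinomial_Suc_Suc)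

lemma alt_binomial_eq: "alt_binomial n j = (of_int (int j - n - 1) gchoose j :: 'k::field_char_0)"
  unfolding alt_binomial_def
  by (subst (2) gbinomial_negated_upper) (simp add: algebra_simps)

text \<open>An array \<open>D\<close> stands for the series \<open>\<Sum> D p q x\<^sup>-\<^sup>p\<^sup>-\<^sup>1 y\<^sup>-\<^sup>q\<^sup>-\<^sup>1\<close>.  Multiplication by \<open>x\<close> raises the index
  \<open>p\<close> by one and multiplication by \<open>y\<close> raises \<open>q\<close>, so that this is multiplication by \<open>(x - y)\<^sup>n\<close>.\<close>

fun difference_mult :: "(int \<Rightarrow> int \<Rightarrow> 'w::ab_group_add) \<Rightarrow> nat \<Rightarrow> int \<Rightarrow> int \<Rightarrow> 'w" where
  "difference_mult D 0 p q = D p q"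
| "difference_mult D (Suc n) p q = difference_mult D n (p + 1) q - difference_mult D n p (q + 1)"

lemma difference_mult_0: "difference_mult D 0 = D"
  by (intro ext) simp

lemma difference_mult_diff:
  "difference_mult (\<lambda>p q. D p q - E p q) n p q = difference_mult D n p q - difference_mult E n p q"
  by (induction n arbitrary: p q) (auto simp: algebra_simps)

lemma difference_mult_Suc':
  "difference_mult (\<lambda>p q. D (p + 1) q - D p (q + 1)) n p q = difference_mult D (Suc n) p q"
  by (induction n arbitrary: p q) auto

lemma difference_mult_add:
  "difference_mult (difference_mult D m) n p q = difference_mult D (m + n) p q"
proof (induction n arbitrary: p q)
  case (Suc n)
  then show ?case by simp
qed simp

lemma difference_mult_zero: "difference_mult (\<lambda>p q. 0) n p q = 0"
  by (induction n arbitrary: p q) auto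

lemma difference_mult_mono:
  assumes "\<And>p q. difference_mult D m p q = 0" "m \<le> n"
  shows "difference_mult D n p q = 0"
proof -
  have "difference_mult D n p q = difference_mult (difference_mult D m) (n - m) p q"
    using assms(2) by (simp add: difference_mult_add)
  also have "difference_mult D m = (\<lambda>p q. 0)" using assms(1) by blast
  finally show ?thesis by (simp add: difference_mult_zero)
qed

lemma difference_mult_vanish_right:
  assumes "\<And>p q. Q \<le> q \<Longrightarrow> D p q = 0"
  shows "Q \<le> q \<Longrightarrow> difference_mult D n p q = 0"
  using assms by (induction n arbitrary: p q) auto

lemma difference_mult_vanish_left:
  assumes "\<And>p q. P \<le> p \<Longrightarrow> D p q = 0"
  shows "P \<le> p \<Longrightarrow> difference_mult D n p q = 0"
  using assms by (induction n arbitrary: p q) auto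

text \<open>A nonzero series with powers of \<open>x\<close> bounded below is not annihilated by a power of \<open>x - y\<close>.  If \<open>x - y\<close>
  kills it, then its coefficients are constant along the antidiagonals, and each antidiagonal runs
  into the region where the coefficients vanish.  This is why the choice of the exponent in the
  definition of \<open>Y\<^sub>\<E>\<close> does not matter.\<close>

lemma difference_mult_cancel:
  assumes zero: "\<And>p q. difference_mult D n p q = 0"
    and vanish: "\<And>p q. P \<le> p \<Longrightarrow> D p q = 0"
  shows "D p q = 0"
  using assms
proof (induction n arbitrary: D p q)
  case (Suc n)
  define E where "E = (\<lambda>p q. D (p + 1) q - D p (q + 1))"
  have "E p q = 0" for p q
  proof (rule Suc.IH)
    show "difference_mult E n p q = 0" for p q
      unfolding E_def difference_mult_Suc' by (rule Suc.prems(1))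
    show "E p q = 0" if "P \<le> p" for p q
      using that Suc.prems(2) by (simp add: E_def)
  qed
  then have step: "D p q = D (p + 1) (q - 1)" for p q
    unfolding E_def by (metis diff_add_cancel eq_iff_diff_eq_0)
  have "D p q = D (p + int i) (q - int i)" for i
  proof (induction i)
    case (Suc i)
    then show ?case using step[of "p + int i" "q - int i"] by (simp add: algebra_simps)
  qed simp
  from this[of "nat (P - p)"] show ?case using Suc.prems(2) by simp
qed simp

lemma difference_mult_flip:
  "difference_mult (\<lambda>q p. D p q) n q p = (if even n then difference_mult D n p q else - difference_mult D n p q)"
  by (induction n arbitrary: p q) auto

text \<open>The recursion determines the values at \<open>(m, n)\<close> from those at \<open>(m + 1, n)\<close> and \<open>(m, n + 1)\<close>, with
  \<open>k\<close> shifted.  Descending in both parameters from the two regions where the values are known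
  reaches every point.\<close>

lemma pascal_recursion_zero:
  fixes D :: "int \<Rightarrow> int \<Rightarrow> int \<Rightarrow> 'w::ab_group_add"
  assumes rec: "\<And>m n k. D (m + 1) n k = D m n (k + 1) + D m (n + 1) k"
    and n: "\<And>m n k. N \<le> n \<Longrightarrow> D m n k = 0"
    and m: "\<And>m n k. M \<le> m \<Longrightarrow> D m n k = 0"
  shows "D m n k = 0"
proof -
  have "D m n k = 0" if "nat (M - m) + nat (N - n) = i" for i m n k
    using that
  proof (induction i arbitrary: m n k rule: less_induct)
    case (less i)
    show ?case
    proof (cases "M \<le> m \<or> N \<le> n")
      case True
      then show ?thesis using m n by blast
    next
      case False
      have "D (m + 1) n (k - 1) = 0" "D m (n + 1) (k - 1) = 0"
        by (rule less.IH[OF _ refl]; use less.prems False in linarith)+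
      with rec[of m n "k - 1"] show ?thesis by simp
    qed
  qed
  then show ?thesis by blast
qed

lemma pascal_recursion_zero_nonneg:
  fixes D :: "int \<Rightarrow> int \<Rightarrow> int \<Rightarrow> 'w::ab_group_add"
  assumes rec: "\<And>m n k. D (m + 1) n k = D m n (k + 1) + D m (n + 1) k"
    and m: "\<And>n k. D 0 n k = 0"
  shows "0 \<le> m \<Longrightarrow> D m n k = 0"
proof (induction m arbitrary: n k rule: int_ge_induct)
  case (step i)
  then show ?case by (simp add: rec)
qed (use m in simp)

section \<open>The two sides of the Borcherds identity\<close>

locale char0_vector_space = vector_space scale
  for scale :: "'k::field_char_0 \<Rightarrow> 'w::ab_group_add \<Rightarrow> 'w" (infixr \<open>\<cdot>\<close> 75)
begin

text \<open>For the array of a series \<open>X(x, y)\<close> in which the powers of \<open>y\<close> are bounded below, this is the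
  coefficient of \<open>x\<^sup>-\<^sup>1 y\<^sup>-\<^sup>1\<close> in \<open>x\<^sup>m y\<^sup>k (x - y)\<^sup>n X(x, y)\<close>, with \<open>(x - y)\<^sup>n\<close> expanded in nonnegative
  powers of \<open>y\<close>.\<close>

definition binomial_sum :: "(int \<Rightarrow> int \<Rightarrow> 'w) \<Rightarrow> int \<Rightarrow> int \<Rightarrow> int \<Rightarrow> 'w" where
  "binomial_sum X m n k = Sum_any (\<lambda>j. alt_binomial n j \<cdot> X (m + n - int j) (k + int j))"

text \<open>With \<open>X(x, y) = a(x) b(y) w\<close> and \<open>Y(y, x) = b(y) a(x) w\<close> this is the coefficient of \<open>x\<^sup>-\<^sup>1 y\<^sup>-\<^sup>1\<close> in
  \<open>x\<^sup>m y\<^sup>k ((x - y)\<^sup>n a(x) b(y) - (- y + x)\<^sup>n b(y) a(x)) w\<close>.  The array \<open>Y\<close> takes the index that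
  belongs to \<open>y\<close> first; hence the exchange of \<open>m\<close> and \<open>k\<close> in the second sum.\<close>

definition jacobi_lhs :: "(int \<Rightarrow> int \<Rightarrow> 'w) \<Rightarrow> (int \<Rightarrow> int \<Rightarrow> 'w) \<Rightarrow> int \<Rightarrow> int \<Rightarrow> int \<Rightarrow> 'w" where
  "jacobi_lhs X Y m n k = binomial_sum X m n k - (- 1) powi n \<cdot> binomial_sum Y k n m"

text \<open>With \<open>Z p q\<close> the action of the mode \<open>(a\<^sub>(\<^sub>p\<^sub>) b)\<^sub>(\<^sub>q\<^sub>)\<close>, this is the right side of the Borcherds
  identity: \<open>x\<^sup>m = (y + (x - y))\<^sup>m\<close> is expanded in powers of \<open>x - y\<close>.\<close>

definition jacobi_rhs :: "(int \<Rightarrow> int \<Rightarrow> 'w) \<Rightarrow> int \<Rightarrow> int \<Rightarrow> int \<Rightarrow> 'w" where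
  "jacobi_rhs Z m n k = Sum_any (\<lambda>j. (of_int m gchoose j) \<cdot> Z (n + int j) (m + k - int j))"

lemma binomial_sum_lessThan:
  assumes "\<And>p q. Q \<le> q \<Longrightarrow> X p q = 0" and "nat (Q - k) \<le> B"
  shows "binomial_sum X m n k = (\<Sum>j<B. alt_binomial n j \<cdot> X (m + n - int j) (k + int j))"
  unfolding binomial_sum_def by (rule Sum_any_lessThan) (use assms in simp)

lemma jacobi_rhs_lessThan:
  assumes "\<And>p q. N \<le> p \<Longrightarrow> Z p q = 0" and "nat (N - n) \<le> B"
  shows "jacobi_rhs Z m n k = (\<Sum>j<B. (of_int m gchoose j) \<cdot> Z (n + int j) (m + k - int j))"
  unfolding jacobi_rhs_def by (rule Sum_any_lessThan) (use assms in simp)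

text \<open>This is \<open>(x - y)\<^sup>n\<^sup>+\<^sup>1 = x (x - y)\<^sup>n - y (x - y)\<^sup>n\<close>.  The boundedness of the indices makes the sums
  finite, so that they can be split.\<close>

lemma binomial_sum_Suc:
  assumes X: "\<And>p q. Q \<le> q \<Longrightarrow> X p q = 0"
  shows "binomial_sum X m (n + 1) k = binomial_sum X (m + 1) n k - binomial_sum X m n (k + 1)"
proof -
  define B where "B = nat (Q - k)"
  have "binomial_sum X m (n + 1) k
      = (\<Sum>j<Suc B. alt_binomial (n + 1) j \<cdot> X (m + (n + 1) - int j) (k + int j))"
    by (rule binomial_sum_lessThan[OF X]) (auto simp: B_def)
  also have "\<dots> = X (m + n + 1) k
      + (\<Sum>j<B. alt_binomial n (Suc j) \<cdot> X (m + n - int j) (k + 1 + int j))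
      - (\<Sum>j<B. alt_binomial n j \<cdot> X (m + n - int j) (k + 1 + int j))"
    unfolding sum.lessThan_Suc_shift
    by (simp add: alt_binomial_Suc' scale_left_diff_distrib sum_subtractf algebra_simps)
  also have "X (m + n + 1) k
      + (\<Sum>j<B. alt_binomial n (Suc j) \<cdot> X (m + n - int j) (k + 1 + int j))
      = (\<Sum>j<Suc B. alt_binomial n j \<cdot> X (m + 1 + n - int j) (k + int j))"
    unfolding sum.lessThan_Suc_shift by (simp add: algebra_simps)
  also have "\<dots> = binomial_sum X (m + 1) n k"
    by (rule binomial_sum_lessThan[OF X, symmetric]) (auto simp: B_def)
  also have "(\<Sum>j<B. alt_binomial n j \<cdot> X (m + n - int j) (k + 1 + int j)) = binomial_sum X m n (k + 1)"
    by (rule binomial_sum_lessThan[OF X, symmetric]) (auto simp: B_def)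
  finally show ?thesis .
qed

lemma jacobi_lhs_Suc:
  assumes X: "\<And>p q. Q \<le> q \<Longrightarrow> X p q = 0" and Y: "\<And>q p. P \<le> p \<Longrightarrow> Y q p = 0"
  shows "jacobi_lhs X Y (m + 1) n k = jacobi_lhs X Y m n (k + 1) + jacobi_lhs X Y m (n + 1) k"
  by (simp add: jacobi_lhs_def binomial_sum_Suc[of Q X, OF X] binomial_sum_Suc[of P Y, OF Y]
      power_int_add scale_right_diff_distrib)

lemma jacobi_rhs_Suc:
  assumes Z: "\<And>p q. N \<le> p \<Longrightarrow> Z p q = 0"
  shows "jacobi_rhs Z (m + 1) n k = jacobi_rhs Z m n (k + 1) + jacobi_rhs Z m (n + 1) k"
proof -
  define B where "B = nat (N - n)"
  have "jacobi_rhs Z (m + 1) n k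
      = (\<Sum>j<Suc B. (of_int (m + 1) gchoose j) \<cdot> Z (n + int j) (m + 1 + k - int j))"
    by (rule jacobi_rhs_lessThan[OF Z]) (auto simp: B_def)
  also have "\<dots> = Z n (m + 1 + k)
      + (\<Sum>j<B. (of_int m gchoose Suc j) \<cdot> Z (n + 1 + int j) (m + k - int j))
      + (\<Sum>j<B. (of_int m gchoose j) \<cdot> Z (n + 1 + int j) (m + k - int j))"
    unfolding sum.lessThan_Suc_shift
    by (simp add: gbinomial_Suc_Suc' scale_left_distrib sum.distrib algebra_simps)
  also have "Z n (m + 1 + k)
      + (\<Sum>j<B. (of_int m gchoose Suc j) \<cdot> Z (n + 1 + int j) (m + k - int j))
      = (\<Sum>j<Suc B. (of_int m gchoose j) \<cdot> Z (n + int j) (m + (k + 1) - int j))"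
    unfolding sum.lessThan_Suc_shift by (simp add: algebra_simps)
  also have "\<dots> = jacobi_rhs Z m n (k + 1)"
    by (rule jacobi_rhs_lessThan[OF Z, symmetric]) (auto simp: B_def)
  also have "(\<Sum>j<B. (of_int m gchoose j) \<cdot> Z (n + 1 + int j) (m + k - int j)) = jacobi_rhs Z m (n + 1) k"
    by (rule jacobi_rhs_lessThan[OF Z, symmetric]) (auto simp: B_def)
  finally show ?thesis .
qed

lemma binomial_sum_0: "binomial_sum X m 0 k = X m k"
  unfolding binomial_sum_def by (subst Sum_any_lessThan[of 1]) (auto simp: alt_binomial_zero)

lemma jacobi_rhs_0: "jacobi_rhs Z 0 n k = Z n k"
  unfolding jacobi_rhs_def by (subst Sum_any_lessThan[of 1]) (auto simp: gbinomial_0_left)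

text \<open>For a nonnegative exponent the two expansions of \<open>(x - y)\<^sup>n\<close> coincide, and only the commutator is
  left.\<close>

lemma jacobi_lhs_of_nat:
  assumes X: "\<And>p q. Q \<le> q \<Longrightarrow> X p q = 0" and Y: "\<And>q p. P \<le> p \<Longrightarrow> Y q p = 0"
  shows "jacobi_lhs X Y m (int n) k = difference_mult (\<lambda>p q. X p q - Y q p) n m k"
proof (induction n arbitrary: m k)
  case 0
  then show ?case by (simp add: jacobi_lhs_def binomial_sum_0)
next
  case (Suc n)
  have "jacobi_lhs X Y m (int n + 1) k = jacobi_lhs X Y (m + 1) (int n) k - jacobi_lhs X Y m (int n) (k + 1)"
    using jacobi_lhs_Suc[where X = X and Y = Y and Q = Q and P = P, OF X Y] by simp
  then show ?case by (simp add: Suc.IH add.commute)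
qed

text \<open>A factor \<open>(x - y)\<^sup>i\<close> can be moved from the expanded binomial to the series.\<close>

lemma binomial_sum_shift:
  assumes X: "\<And>p q. Q \<le> q \<Longrightarrow> X p q = 0"
  shows "binomial_sum X m (n + int i) k = binomial_sum (difference_mult X i) m n k"
proof (induction i arbitrary: m k)
  case (Suc i)
  let ?D = "difference_mult X i"
  have D: "?D p q = 0" if "Q \<le> q" for p q
    using difference_mult_vanish_right[where D = X and Q = Q] X that by blast
  have D': "?D p (q + 1) = 0" if "Q \<le> q" for p q
    by (rule D) (use that in simp)
  define B where "B = nat (Q - k)"
  have "binomial_sum X m (n + int (Suc i)) k = binomial_sum X m ((n + int i) + 1) k"
    by (simp add: algebra_simps)
  also have "\<dots> = binomial_sum ?D (m + 1) n k - binomial_sum ?D m n (k + 1)"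
    by (simp add: binomial_sum_Suc[of Q X, OF X] Suc.IH)
  also have "\<dots> = binomial_sum (difference_mult X (Suc i)) m n k"
    by (subst (1 2 3) binomial_sum_lessThan[where Q = Q and B = B])
      (auto simp: D D' B_def sum_subtractf scale_right_diff_distrib algebra_simps)
  finally show ?case .
qed (simp add: difference_mult_0)

lemma difference_mult_closed_form:
  "difference_mult D n p q = (\<Sum>j\<le>n. alt_binomial (int n) j \<cdot> D (p + int n - int j) (q + int j))"
proof (induction n arbitrary: p q)
  case (Suc n)
  have z: "(alt_binomial (int n) (Suc n) :: 'k) = 0"
    by (simp add: alt_binomial_def flip: binomial_gbinomial)
  have eq: "D (1 + (p + (int n - int j))) q' = D (p + 1 + int n - int j) q'" for j q'
    by (simp add: algebra_simps)
  have "difference_mult D (Suc n) p q =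
      (\<Sum>j\<le>n. alt_binomial (int n) j \<cdot> D (p + 1 + int n - int j) (q + int j))
    - (\<Sum>j\<le>n. alt_binomial (int n) j \<cdot> D (p + int n - int j) (q + 1 + int j))"
    by (simp add: Suc.IH)
  also have "(\<Sum>j\<le>n. alt_binomial (int n) j \<cdot> D (p + 1 + int n - int j) (q + int j))
      = (\<Sum>j\<le>Suc n. alt_binomial (int n) j \<cdot> D (p + 1 + int n - int j) (q + int j))"
    using z by simp
  also have "\<dots> = D (p + 1 + int n) q
    + (\<Sum>j\<le>n. alt_binomial (int n) (Suc j) \<cdot> D (p + int n - int j) (q + 1 + int j))"
    by (subst sum.atMost_Suc_shift) (simp add: algebra_simps)
  also have "\<dots> - (\<Sum>j\<le>n. alt_binomial (int n) j \<cdot> D (p + int n - int j) (q + 1 + int j))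
      = D (p + 1 + int n) q
    + (\<Sum>j\<le>n. alt_binomial (int n + 1) (Suc j) \<cdot> D (p + int n - int j) (q + 1 + int j))"
    by (simp add: alt_binomial_Suc scale_left_diff_distrib sum_subtractf)
  also have "\<dots> = (\<Sum>j\<le>Suc n. alt_binomial (int (Suc n)) j \<cdot> D (p + int (Suc n) - int j) (q + int j))"
    by (subst sum.atMost_Suc_shift) (simp add: algebra_simps)
  finally show ?case .
qed simp

section \<open>Formal fields and their products\<close>

abbreviation linear_op :: "('w \<Rightarrow> 'w) \<Rightarrow> bool" where
  "linear_op \<equiv> module_hom scale scale"

lemma linear_opI:
  assumes "\<And>u v. A (u + v) = A u + A v" "\<And>c u. A (c \<cdot> u) = c \<cdot> A u"
  shows "linear_op A"
  by unfold_locales (use assms in \<open>auto simp: algebra_simps\<close>)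

text \<open>A field \<open>\<Sum> f\<^sub>n x\<^sup>-\<^sup>n\<^sup>-\<^sup>1\<close> is given by the sequence of its modes.\<close>

definition formal_field :: "(int \<Rightarrow> 'w \<Rightarrow> 'w) \<Rightarrow> bool" where
  "formal_field f \<longleftrightarrow> (\<forall>n. linear_op (f n)) \<and> (\<forall>w. \<exists>N. \<forall>n\<ge>N. f n w = 0)"

lemma field_linear: "formal_field f \<Longrightarrow> linear_op (f n)"
  by (simp add: formal_field_def)

lemma field_bound: 
  assumes "formal_field f" obtains N where "\<And>n. N \<le> n \<Longrightarrow> f n w = 0"
  using assms unfolding formal_field_def by blast

lemma field_zero [simp]: "formal_field f \<Longrightarrow> f n 0 = 0"
  using field_linear module_hom.zero by blast

lemma field_add: "formal_field f \<Longrightarrow> f n (u + v) = f n u + f n v"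
  using field_linear module_hom.add by blast

lemma field_diff: "formal_field f \<Longrightarrow> f n (u - v) = f n u - f n v"
  using field_linear module_hom.diff by blast

lemma field_minus: "formal_field f \<Longrightarrow> f n (- u) = - f n u"
  using field_linear module_hom.neg by blast

lemma field_scale: "formal_field f \<Longrightarrow> f n (c \<cdot> u) = c \<cdot> f n u"
  using field_linear module_hom.scale by blast

lemma field_sum: "formal_field f \<Longrightarrow> f n (sum u S) = (\<Sum>i\<in>S. f n (u i))"
  using field_linear module_hom.sum by blast

lemma fieldI:
  assumes "\<And>n u v. f n (u + v) = f n u + f n v" "\<And>n c u. f n (c \<cdot> u) = c \<cdot> f n u"
    and "\<And>w. \<exists>N. \<forall>n\<ge>N. f n w = 0"
  shows "formal_field f"
  using assms by (auto simp: formal_field_def intro!: linear_opI)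

text \<open>The residue in \<open>x\<close> of \<open>(x - y)\<^sup>n f(x) g(y) - (- y + x)\<^sup>n g(y) f(x)\<close>: the exponent of \<open>x\<close> is \<open>0\<close> and
  the power \<open>y\<^sup>k\<close> picks out the mode \<open>k\<close>.\<close>

definition nth_product :: "int \<Rightarrow> (int \<Rightarrow> 'w \<Rightarrow> 'w) \<Rightarrow> (int \<Rightarrow> 'w \<Rightarrow> 'w) \<Rightarrow> int \<Rightarrow> 'w \<Rightarrow> 'w" where
  "nth_product n f g k w = jacobi_lhs (\<lambda>p q. f p (g q w)) (\<lambda>q p. g q (f p w)) 0 n k"

text \<open>Some power of \<open>x - y\<close> annihilates the commutator of \<open>f(x)\<close> and \<open>g(y)\<close>, uniformly in the vector.\<close>

definition local_fields :: "(int \<Rightarrow> 'w \<Rightarrow> 'w) \<Rightarrow> (int \<Rightarrow> 'w \<Rightarrow> 'w) \<Rightarrow> bool" where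
  "local_fields f g \<longleftrightarrow>
     (\<exists>N. \<forall>w p q. difference_mult (\<lambda>p q. f p (g q w) - g q (f p w)) N p q = 0)"

text \<open>The sums in the product are finite on each vector, with a length that depends on the vector.
  Calculations use a common cutoff \<open>B\<close> and statements that hold for all large \<open>B\<close>.\<close>

definition partial_product ::
    "nat \<Rightarrow> int \<Rightarrow> (int \<Rightarrow> 'w \<Rightarrow> 'w) \<Rightarrow> (int \<Rightarrow> 'w \<Rightarrow> 'w) \<Rightarrow> int \<Rightarrow> 'w \<Rightarrow> 'w" where
  "partial_product B n f g k w =
     (\<Sum>j<B. alt_binomial n j \<cdot> f (n - int j) (g (k + int j) w))
     - (- 1) powi n \<cdot> (\<Sum>j<B. alt_binomial n j \<cdot> g (k + n - int j) (f (int j) w))"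

lemma partial_product_eq:
  assumes f: "formal_field f" and g: "formal_field g"
    and P: "\<And>n. P \<le> n \<Longrightarrow> f n w = 0" and Q: "\<And>n. Q \<le> n \<Longrightarrow> g n w = 0"
    and "nat P \<le> B" "nat (Q - k) \<le> B"
  shows "nth_product n f g k w = partial_product B n f g k w"
  unfolding nth_product_def jacobi_lhs_def partial_product_def
  using assms
  by (simp add: binomial_sum_lessThan[where Q = Q and B = B]
      binomial_sum_lessThan[where Q = P and B = B])

lemma eventually_partial_product:
  assumes f: "formal_field f" and g: "formal_field g"
  shows "\<forall>\<^sub>F B in sequentially. nth_product n f g k w = partial_product B n f g k w"
proof -
  obtain P where P: "\<And>n. P \<le> n \<Longrightarrow> f n w = 0" using field_bound[OF f] by blast
  obtain Q where Q: "\<And>n. Q \<le> n \<Longrightarrow> g n w = 0" using field_bound[OF g] by blast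
  have "nth_product n f g k w = partial_product B n f g k w" if "max (nat P) (nat (Q - k)) \<le> B" for B
    by (rule partial_product_eq[OF f g P Q]) (use that in auto)
  then show ?thesis unfolding eventually_sequentially by blast
qed

lemma field_plus:
  assumes f: "formal_field f" and g: "formal_field g"
  shows "formal_field (\<lambda>p w. f p w + g p w)"
proof (rule fieldI)
  fix w
  obtain P where P: "\<And>n. P \<le> n \<Longrightarrow> f n w = 0" using field_bound[OF f] by blast
  obtain Q where Q: "\<And>n. Q \<le> n \<Longrightarrow> g n w = 0" using field_bound[OF g] by blast
  show "\<exists>N. \<forall>n\<ge>N. f n w + g n w = 0" by (rule exI[of _ "max P Q"]) (use P Q in auto)
qed (use f g in \<open>auto simp: field_add field_scale scale_right_distrib\<close>)

lemma field_scale_shift: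
  assumes f: "formal_field f"
  shows "formal_field (\<lambda>p w. c p \<cdot> f (p + a) w)"
proof (rule fieldI)
  fix w
  obtain P where P: "\<And>n. P \<le> n \<Longrightarrow> f n w = 0" using field_bound[OF f] by blast
  show "\<exists>N. \<forall>n\<ge>N. c n \<cdot> f (n + a) w = 0" by (rule exI[of _ "P - a"]) (use P in auto)
qed (use f in \<open>auto simp: field_add field_scale scale_right_distrib mult.commute\<close>)

lemma field_zero_field: "formal_field (\<lambda>p w. 0)"
  by (rule fieldI) auto

lemma field_sum_field:
  "(\<And>i. i \<in> S \<Longrightarrow> formal_field (f i)) \<Longrightarrow> formal_field (\<lambda>p w. \<Sum>i\<in>S. f i p w)"
proof (induction S rule: infinite_finite_induct)
  case (insert x F)
  then show ?case using field_plus[of "f x" "\<lambda>p w. \<Sum>i\<in>F. f i p w"] by simp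
qed (auto intro: field_zero_field)

lemma nth_product_add_right:
  assumes f: "formal_field f" and g: "formal_field g" and h: "formal_field h"
  shows "nth_product n f (\<lambda>p w. g p w + h p w) k w = nth_product n f g k w + nth_product n f h k w"
proof -
  have "\<forall>\<^sub>F B in sequentially. nth_product n f (\<lambda>p w. g p w + h p w) k w
      = nth_product n f g k w + nth_product n f h k w"
    using eventually_partial_product[OF f field_plus[OF g h], of n k w]
      eventually_partial_product[OF f g, of n k w] eventually_partial_product[OF f h, of n k w]
    by eventually_elim
      (simp add: partial_product_def field_add[OF f] scale_right_distrib sum.distrib)
  then show ?thesis by simp
qed

lemma nth_product_add_left:
  assumes f: "formal_field f" and g: "formal_field g" and h: "formal_field h"
  shows "nth_product n (\<lambda>p w. f p w + g p w) h k w = nth_product n f h k w + nth_product n g h k w"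
proof -
  have "\<forall>\<^sub>F B in sequentially. nth_product n (\<lambda>p w. f p w + g p w) h k w
      = nth_product n f h k w + nth_product n g h k w"
    using eventually_partial_product[OF field_plus[OF f g] h, of n k w]
      eventually_partial_product[OF f h, of n k w] eventually_partial_product[OF g h, of n k w]
    by eventually_elim
      (simp add: partial_product_def field_add[OF h] scale_right_distrib sum.distrib)
  then show ?thesis by simp
qed

lemma nth_product_scale_right:
  assumes f: "formal_field f" and g: "formal_field g"
  shows "nth_product n f (\<lambda>p w. c \<cdot> g p w) k w = c \<cdot> nth_product n f g k w"
proof -
  have "\<forall>\<^sub>F B in sequentially. nth_product n f (\<lambda>p w. c \<cdot> g p w) k w = c \<cdot> nth_product n f g k w"
    using eventually_partial_product[OF f field_scale_shift[OF g, where c = "\<lambda>_. c" and a = 0], of n k w]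
      eventually_partial_product[OF f g, of n k w]
    by eventually_elim
      (simp add: partial_product_def field_scale[OF f] scale_sum_right mult_ac
         scale_right_diff_distrib)
  then show ?thesis by simp
qed

lemma nth_product_scale_left:
  assumes f: "formal_field f" and g: "formal_field g"
  shows "nth_product n (\<lambda>p w. c \<cdot> f p w) g k w = c \<cdot> nth_product n f g k w"
proof -
  have "\<forall>\<^sub>F B in sequentially. nth_product n (\<lambda>p w. c \<cdot> f p w) g k w = c \<cdot> nth_product n f g k w"
    using eventually_partial_product[OF field_scale_shift[OF f, where c = "\<lambda>_. c" and a = 0] g, of n k w]
      eventually_partial_product[OF f g, of n k w]
    by eventually_elim
      (simp add: partial_product_def field_scale[OF g] scale_sum_right mult_ac
         scale_right_diff_distrib)
  then show ?thesis by simp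
qed

lemma nth_product_zero_right: "formal_field f \<Longrightarrow> nth_product n f (\<lambda>p w. 0) k w = 0"
  using nth_product_scale_right[OF _ field_zero_field, of f n 0 k w] by simp

lemma nth_product_zero_left: "formal_field g \<Longrightarrow> nth_product n (\<lambda>p w. 0) g k w = 0"
  using nth_product_scale_left[OF field_zero_field, of g n 0 k w] by simp

lemma nth_product_sum_right:
  assumes f: "formal_field f" and g: "\<And>i. i \<in> S \<Longrightarrow> formal_field (g i)"
  shows "nth_product n f (\<lambda>p w. \<Sum>i\<in>S. g i p w) k w = (\<Sum>i\<in>S. nth_product n f (g i) k w)"
  using g
proof (induction S rule: infinite_finite_induct)
  case (insert x F)
  then show ?case
    using nth_product_add_right[OF f insert.prems[of x] field_sum_field[of F g]] by simp
qed (use f in \<open>auto simp: nth_product_zero_right\<close>)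

text \<open>The powers are bounded below because only finitely many vectors \<open>f\<^sub>j w\<close> with \<open>j \<ge> 0\<close> are
  nonzero, and \<open>g\<close> has bounded powers on each of them.\<close>

lemma field_nth_product:
  assumes f: "formal_field f" and g: "formal_field g"
  shows "formal_field (nth_product n f g)"
proof (rule fieldI)
  fix k u v
  have "\<forall>\<^sub>F B in sequentially. nth_product n f g k (u + v) = nth_product n f g k u + nth_product n f g k v"
    using eventually_partial_product[OF f g, of n k "u + v"]
      eventually_partial_product[OF f g, of n k u] eventually_partial_product[OF f g, of n k v]
    by eventually_elim
      (simp add: partial_product_def field_add[OF f] field_add[OF g] scale_right_distrib sum.distrib)
  then show "nth_product n f g k (u + v) = nth_product n f g k u + nth_product n f g k v" by simp
next
  fix k c u
  have "\<forall>\<^sub>F B in sequentially. nth_product n f g k (c \<cdot> u) = c \<cdot> nth_product n f g k u"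
    using eventually_partial_product[OF f g, of n k "c \<cdot> u"] eventually_partial_product[OF f g, of n k u]
    by eventually_elim
      (simp add: partial_product_def field_scale[OF f] field_scale[OF g] scale_sum_right mult_ac
         scale_right_diff_distrib)
  then show "nth_product n f g k (c \<cdot> u) = c \<cdot> nth_product n f g k u" by simp
next
  fix w
  obtain P where P: "\<And>n. P \<le> n \<Longrightarrow> f n w = 0" using field_bound[OF f] by blast
  obtain Q where Q: "\<And>n. Q \<le> n \<Longrightarrow> g n w = 0" using field_bound[OF g] by blast
  have "\<forall>j. \<exists>R. \<forall>k\<ge>R. g k (f (int j) w) = 0" using g by (auto simp: formal_field_def)
  then obtain R where R: "\<And>j k. R j \<le> k \<Longrightarrow> g k (f (int j) w) = 0" by metis
  define M where "M = Max (insert Q (R ` {..<nat P}))"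
  show "\<exists>N. \<forall>k\<ge>N. nth_product n f g k w = 0"
  proof (intro exI[of _ "max Q (M + \<bar>n\<bar> + int (nat P))"] allI impI)
    fix k assume k: "max Q (M + \<bar>n\<bar> + int (nat P)) \<le> k"
    have "g (k + n - int j) (f (int j) w) = 0" for j
    proof (cases "j < nat P")
      case True
      then have "R j \<le> M" unfolding M_def by (intro Max_ge) auto
      then show ?thesis using R[of j "k + n - int j"] k True by linarith
    qed (use P g in auto)
    moreover have "f (n - int j) (g (k + int j) w) = 0" for j using Q[of "k + int j"] k f by simp
    ultimately have "partial_product B n f g k w = 0" for B
      by (simp add: partial_product_def)
    moreover have "\<forall>\<^sub>F B in sequentially. nth_product n f g k w = partial_product B n f g k w"
      by (rule eventually_partial_product[OF f g])
    ultimately show "nth_product n f g k w = 0" by simp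
  qed
qed

text \<open>The modes of \<open>d/dx f(x)\<close>.\<close>

definition derivative :: "(int \<Rightarrow> 'w \<Rightarrow> 'w) \<Rightarrow> int \<Rightarrow> 'w \<Rightarrow> 'w" where
  "derivative f k w = (- of_int k) \<cdot> f (k - 1) w"

lemma field_derivative: "formal_field f \<Longrightarrow> formal_field (derivative f)"
  using field_scale_shift[of f "\<lambda>k. - of_int k" "-1"] by (simp add: derivative_def[abs_def])

lemma alt_binomial_absorption:
  "of_nat (Suc j) * alt_binomial n (Suc j) = - (of_int n * alt_binomial (n - 1) j :: 'k)"
proof -
  have "of_nat (Suc j) * alt_binomial n (Suc j)
      = - ((- 1) ^ j * (of_nat (Suc j) * (of_int n gchoose Suc j)) :: 'k)"
    by (simp add: alt_binomial_def mult_ac del: of_nat_Suc)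
  also have "\<dots> = - (of_int n * alt_binomial (n - 1) j)"
    unfolding gbinomial_absorption by (simp add: alt_binomial_def mult_ac)
  finally show ?thesis .
qed

lemma alt_binomial_absorb_comp:
  "(of_int n - of_nat j) * alt_binomial n j = (of_int n * alt_binomial (n - 1) j :: 'k)"
proof -
  have "(of_int n - of_nat j) * alt_binomial n j
      = ((- 1) ^ j * ((of_int n - of_nat j) * (of_int n gchoose j)) :: 'k)"
    by (simp add: alt_binomial_def mult_ac)
  also have "\<dots> = of_int n * alt_binomial (n - 1) j"
    unfolding gbinomial_absorb_comp by (simp add: alt_binomial_def mult_ac)
  finally show ?thesis .
qed

text \<open>Integration by parts in the residue.\<close>

lemma nth_product_derivative_left:
  assumes f: "formal_field f" and g: "formal_field g"
  shows "nth_product n (derivative f) g k w = (- of_int n) \<cdot> nth_product (n - 1) f g k w"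
proof -
  obtain P where P: "\<And>n. P \<le> n \<Longrightarrow> f n w = 0" using field_bound[OF f] by blast
  have ev: "\<forall>\<^sub>F B in sequentially. f (int B) w = 0"
    unfolding eventually_sequentially by (rule exI[of _ "nat P"]) (use P in auto)
  have 1: "alt_binomial n j \<cdot> derivative f (n - int j) (g (k + int j) w)
      = (- of_int n) \<cdot> (alt_binomial (n - 1) j \<cdot> f (n - 1 - int j) (g (k + int j) w))" for j
    using alt_binomial_absorb_comp[of n j]
    by (simp add: derivative_def algebra_simps)
  \<comment> \<open>the term \<open>j = 0\<close> vanishes, so the index shifts by one; hence the cutoffs \<open>Suc B\<close> and \<open>B\<close>\<close>
  have 2: "(\<Sum>j<Suc B. alt_binomial n j \<cdot> g (k + n - int j) (derivative f (int j) w))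
     = of_int n \<cdot> (\<Sum>j<B. alt_binomial (n - 1) j \<cdot> g (k + (n - 1) - int j) (f (int j) w))" for B
  proof -
    have "alt_binomial n (Suc j) \<cdot> g (k + n - int (Suc j)) (derivative f (int (Suc j)) w)
      = of_int n \<cdot> (alt_binomial (n - 1) j \<cdot> g (k + (n - 1) - int j) (f (int j) w))" for j
    proof -
      have "alt_binomial n (Suc j) \<cdot> g (k + n - int (Suc j)) (derivative f (int (Suc j)) w)
        = (- (of_nat (Suc j) * alt_binomial n (Suc j))) \<cdot> g (k + n - int (Suc j)) (f (int j) w)"
        unfolding derivative_def field_scale[OF g] by (simp add: algebra_simps)
      also have "\<dots> = of_int n \<cdot> (alt_binomial (n - 1) j \<cdot> g (k + (n - 1) - int j) (f (int j) w))"
        unfolding alt_binomial_absorption by (simp add: algebra_simps)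
      finally show ?thesis .
    qed
    then show ?thesis
      unfolding sum.lessThan_Suc_shift by (simp add: derivative_def g scale_sum_right)
  qed
  have sign: "(- 1) powi (n - 1) = (- ((- 1) powi n) :: 'k)"
    by (simp add: power_int_diff)
  have "\<forall>\<^sub>F B in sequentially. nth_product n (derivative f) g k w = partial_product (Suc B) n (derivative f) g k w"
    using eventually_partial_product[OF field_derivative[OF f] g]
    by (simp add: eventually_sequentially_Suc[of "\<lambda>B. _ = partial_product B n (derivative f) g k w"])
  moreover have "\<forall>\<^sub>F B in sequentially. nth_product (n - 1) f g k w = partial_product (Suc B) (n - 1) f g k w"
    using eventually_partial_product[OF f g]
    by (simp add: eventually_sequentially_Suc[of "\<lambda>B. _ = partial_product B (n - 1) f g k w"])
  ultimately have "\<forall>\<^sub>F B in sequentially. nth_product n (derivative f) g k w = (- of_int n) \<cdot> nth_product (n - 1) f g k w"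
    using ev
  proof eventually_elim
    case (elim B)
    have "nth_product n (derivative f) g k w =
       (- of_int n) \<cdot> (\<Sum>j<Suc B. alt_binomial (n - 1) j \<cdot> f (n - 1 - int j) (g (k + int j) w))
       - (- 1) powi n \<cdot> of_int n \<cdot> (\<Sum>j<B. alt_binomial (n - 1) j \<cdot> g (k + (n - 1) - int j) (f (int j) w))"
      unfolding elim(1) partial_product_def 1 2 scale_sum_right ..
    also have "(\<Sum>j<B. alt_binomial (n - 1) j \<cdot> g (k + (n - 1) - int j) (f (int j) w))
       = (\<Sum>j<Suc B. alt_binomial (n - 1) j \<cdot> g (k + (n - 1) - int j) (f (int j) w))"
      using elim(3) g by simp
    finally show ?case
      unfolding elim(2) partial_product_def sign
      by (simp add: scale_right_diff_distrib scale_right_distrib mult.commute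
          del: sum.lessThan_Suc)
  qed
  then show ?thesis by simp
qed

text \<open>Together with the previous lemma: the derivative is a derivation of all products.\<close>

lemma nth_product_derivative_right:
  assumes f: "formal_field f" and g: "formal_field g"
  shows "nth_product n f (derivative g) k w
    = derivative (nth_product n f g) k w + of_int n \<cdot> nth_product (n - 1) f g k w"
proof -
  obtain Q where Q: "\<And>n. Q \<le> n \<Longrightarrow> g n w = 0" using field_bound[OF g] by blast
  have ev: "\<forall>\<^sub>F B in sequentially. g (k + int B) w = 0"
    unfolding eventually_sequentially by (rule exI[of _ "nat (Q - k)"]) (use Q in auto)
  have 1: "(\<Sum>j<Suc B. alt_binomial n j \<cdot> f (n - int j) (derivative g (k + int j) w))
     = (- of_int k) \<cdot> (\<Sum>j<Suc B. alt_binomial n j \<cdot> f (n - int j) (g (k - 1 + int j) w))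
      + of_int n \<cdot> (\<Sum>j<B. alt_binomial (n - 1) j \<cdot> f (n - 1 - int j) (g (k + int j) w))" for B
  proof -
    have s: "alt_binomial n (Suc j) \<cdot> f (n - int (Suc j)) (derivative g (k + int (Suc j)) w)
      = (- of_int k) \<cdot> (alt_binomial n (Suc j) \<cdot> f (n - int (Suc j)) (g (k - 1 + int (Suc j)) w))
       + of_int n \<cdot> (alt_binomial (n - 1) j \<cdot> f (n - 1 - int j) (g (k + int j) w))" for j
    proof -
      have "alt_binomial n (Suc j) \<cdot> f (n - int (Suc j)) (derivative g (k + int (Suc j)) w)
        = (- of_int k * alt_binomial n (Suc j) - of_nat (Suc j) * alt_binomial n (Suc j))
           \<cdot> f (n - int (Suc j)) (g (k + int j) w)"
        unfolding derivative_def field_scale[OF f] by (simp add: algebra_simps)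
      also have "\<dots> = (- of_int k) \<cdot> (alt_binomial n (Suc j) \<cdot> f (n - int (Suc j)) (g (k - 1 + int (Suc j)) w))
       + of_int n \<cdot> (alt_binomial (n - 1) j \<cdot> f (n - 1 - int j) (g (k + int j) w))"
        unfolding alt_binomial_absorption by (simp add: algebra_simps)
      finally show ?thesis .
    qed
    show ?thesis
      unfolding sum.lessThan_Suc_shift s
      by (simp add: derivative_def field_scale[OF f] field_minus[OF f] scale_sum_right sum.distrib
          sum_subtractf sum_negf scale_right_distrib)
  qed
  have 2: "alt_binomial n j \<cdot> derivative g (k + n - int j) u
    = (- of_int k) \<cdot> (alt_binomial n j \<cdot> g (k - 1 + n - int j) u)
      - of_int n \<cdot> (alt_binomial (n - 1) j \<cdot> g (k + (n - 1) - int j) u)" for j u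
  proof -
    have "alt_binomial n j \<cdot> derivative g (k + n - int j) u
      = (- of_int k * alt_binomial n j - (of_int n - of_nat j) * alt_binomial n j) \<cdot> g (k - 1 + n - int j) u"
      by (simp add: derivative_def algebra_simps)
    then show ?thesis
      unfolding alt_binomial_absorb_comp by (simp add: algebra_simps)
  qed
  have sign: "(- 1) powi (n - 1) = (- ((- 1) powi n) :: 'k)"
    by (simp add: power_int_diff)
  have "\<forall>\<^sub>F B in sequentially. nth_product n f (derivative g) k w = partial_product (Suc B) n f (derivative g) k w"
    using eventually_partial_product[OF f field_derivative[OF g]]
    by (simp add: eventually_sequentially_Suc[of "\<lambda>B. _ = partial_product B n f (derivative g) k w"])
  moreover have "\<forall>\<^sub>F B in sequentially. nth_product (n - 1) f g k w = partial_product (Suc B) (n - 1) f g k w"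
    using eventually_partial_product[OF f g]
    by (simp add: eventually_sequentially_Suc[of "\<lambda>B. _ = partial_product B (n - 1) f g k w"])
  moreover have "\<forall>\<^sub>F B in sequentially. nth_product n f g (k - 1) w = partial_product (Suc B) n f g (k - 1) w"
    using eventually_partial_product[OF f g]
    by (simp add: eventually_sequentially_Suc[of "\<lambda>B. _ = partial_product B n f g (k - 1) w"])
  ultimately have "\<forall>\<^sub>F B in sequentially. nth_product n f (derivative g) k w
      = derivative (nth_product n f g) k w + of_int n \<cdot> nth_product (n - 1) f g k w"
    using ev
  proof eventually_elim
    case (elim B)
    have z: "(\<Sum>j<B. alt_binomial (n - 1) j \<cdot> f (n - 1 - int j) (g (k + int j) w))
       = (\<Sum>j<Suc B. alt_binomial (n - 1) j \<cdot> f (n - 1 - int j) (g (k + int j) w))"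
      using elim(4) f by simp
    show ?case
      unfolding derivative_def[of "nth_product n f g"] elim(1-3) partial_product_def 1 2 sign z
      by (simp add: scale_right_diff_distrib scale_right_distrib sum_subtractf sum.distrib scale_sum_right sum_negf mult_ac
          del: sum.lessThan_Suc)
  qed
  then show ?thesis by simp
qed

section \<open>The Borcherds identity for two local fields\<close>

lemma local_fieldsE:
  assumes "local_fields f g"
  obtains N where "\<And>n w p q. N \<le> n \<Longrightarrow> difference_mult (\<lambda>p q. f p (g q w) - g q (f p w)) n p q = 0"
  using assms difference_mult_mono unfolding local_fields_def by blast

lemma local_fields_sym: "local_fields f g \<Longrightarrow> local_fields g f"
proof -
  assume "local_fields f g"
  then obtain N where N: "\<And>n w p q. N \<le> n \<Longrightarrow> difference_mult (\<lambda>p q. f p (g q w) - g q (f p w)) n p q = 0"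
    using local_fieldsE by blast
  have "difference_mult (\<lambda>q p. g q (f p w) - f p (g q w)) N q p = 0" for w p q
  proof -
    have "difference_mult (\<lambda>q p. f p (g q w) - g q (f p w)) N q p = 0"
      by (subst difference_mult_flip) (use N[of N] in auto)
    then have "difference_mult (\<lambda>q p. 0 - (f p (g q w) - g q (f p w))) N q p = 0"
      unfolding difference_mult_diff by (simp add: difference_mult_zero)
    then show ?thesis by simp
  qed
  then show ?thesis unfolding local_fields_def by blast
qed

lemma jacobi_lhs_local:
  assumes f: "formal_field f" and g: "formal_field g" and "local_fields f g"
  obtains N where "\<And>n m k w. N \<le> n \<Longrightarrow>
    jacobi_lhs (\<lambda>p q. f p (g q w)) (\<lambda>q p. g q (f p w)) m n k = 0"
proof -
  obtain N where N: "\<And>n w p q. N \<le> n \<Longrightarrow> difference_mult (\<lambda>p q. f p (g q w) - g q (f p w)) n p q = 0"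
    using local_fieldsE assms by blast
  show thesis
  proof (rule that[of "int N"])
    fix n m k w assume n: "int N \<le> n"
    obtain P where P: "\<And>n. P \<le> n \<Longrightarrow> f n w = 0" using field_bound[OF f] by blast
    obtain Q where Q: "\<And>n. Q \<le> n \<Longrightarrow> g n w = 0" using field_bound[OF g] by blast
    have "jacobi_lhs (\<lambda>p q. f p (g q w)) (\<lambda>q p. g q (f p w)) m (int (nat n)) k = 0"
      by (subst jacobi_lhs_of_nat[where Q = Q and P = P]) (use P Q f g N n in auto)
    then show "jacobi_lhs (\<lambda>p q. f p (g q w)) (\<lambda>q p. g q (f p w)) m n k = 0"
      using n by simp
  qed
qed

lemma nth_product_local:
  assumes "formal_field f" "formal_field g" "local_fields f g"
  obtains N where "\<And>n. N \<le> n \<Longrightarrow> nth_product n f g = (\<lambda>k w. 0)"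
  using jacobi_lhs_local[OF assms] unfolding nth_product_def fun_eq_iff by metis

text \<open>Both sides obey the recursion.  For \<open>m = 0\<close> they agree by the definition of the product, hence for
  all \<open>m \<ge> 0\<close>, and for large \<open>n\<close> both vanish by locality.\<close>

theorem borcherds_identity:
  assumes f: "formal_field f" and g: "formal_field g" and loc: "local_fields f g"
  shows "jacobi_rhs (\<lambda>p q. nth_product p f g q w) m n k
    = jacobi_lhs (\<lambda>p q. f p (g q w)) (\<lambda>q p. g q (f p w)) m n k"
proof -
  obtain P where P: "\<And>n. P \<le> n \<Longrightarrow> f n w = 0" using field_bound[OF f] by blast
  obtain Q where Q: "\<And>n. Q \<le> n \<Longrightarrow> g n w = 0" using field_bound[OF g] by blast
  obtain N where N: "\<And>n m k w. N \<le> n \<Longrightarrow>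
    jacobi_lhs (\<lambda>p q. f p (g q w)) (\<lambda>q p. g q (f p w)) m n k = 0"
    using jacobi_lhs_local[OF assms] by blast
  have Z: "nth_product p f g q w = 0" if "N \<le> p" for p q
    using that N by (simp add: nth_product_def)
  define D where "D = (\<lambda>m n k. jacobi_rhs (\<lambda>p q. nth_product p f g q w) m n k
    - jacobi_lhs (\<lambda>p q. f p (g q w)) (\<lambda>q p. g q (f p w)) m n k)"
  have rec: "D (m + 1) n k = D m n (k + 1) + D m (n + 1) k" for m n k
    unfolding D_def
    by (subst jacobi_rhs_Suc[where N = N], use Z in simp,
        subst jacobi_lhs_Suc[where Q = Q and P = P], use P Q f g in auto)
  have "D m n k = 0"
  proof (rule pascal_recursion_zero[of D N 0])
    show "D m n k = 0" if "N \<le> n" for m n k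
    proof -
      have "jacobi_rhs (\<lambda>p q. nth_product p f g q w) m n k = 0"
        unfolding jacobi_rhs_def using that Z by simp
      then show ?thesis using N that by (simp add: D_def)
    qed
    show "D m n k = 0" if "0 \<le> m" for m n k
      by (rule pascal_recursion_zero_nonneg[of D, OF rec])
        (use that in \<open>auto simp: D_def jacobi_rhs_0 nth_product_def\<close>)
  qed (rule rec)
  then show ?thesis by (simp add: D_def)
qed

text \<open>The case of the Borcherds identity with exponents \<open>l\<close>, \<open>n\<close>, \<open>0\<close>: its left side is, up to
  sign, the left side that defines \<open>g\<^sub>(\<^sub>n\<^sub>) f\<close>, with the roles of the two variables exchanged.\<close>

theorem skew_symmetry:
  assumes f: "formal_field f" and g: "formal_field g" and loc: "local_fields f g"
  shows "nth_product n g f l w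
    = (- 1) powi (n + 1) \<cdot> jacobi_rhs (\<lambda>p q. nth_product p f g q w) l n 0"
proof -
  have sign: "(- 1) powi (n + 1) = (- ((- 1) powi n) :: 'k)"
    by (simp add: power_int_add)
  have one: "(- 1) powi n * (- 1) powi n = (1 :: 'k)"
    by (simp flip: power_int_mult_distrib)
  show ?thesis
    unfolding borcherds_identity[OF assms]
    by (simp add: nth_product_def jacobi_lhs_def sign one scale_right_diff_distrib)
qed

section \<open>Weak commutativity of the products\<close>

lemma eventually_iterated_product:
  assumes f: "formal_field f" and g: "formal_field g" and h: "formal_field h"
  shows "\<forall>\<^sub>F B in sequentially. nth_product m f (nth_product k g h) l w =
    (\<Sum>i<B. \<Sum>t<B. (alt_binomial m i * alt_binomial k t) \<cdot>
      (f (m - int i) (g (k - int t) (h (l + int i + int t) w))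
       - (- 1) powi k \<cdot> f (m - int i) (h (l + int i + k - int t) (g (int t) w))
       - (- 1) powi m \<cdot> g (k - int t) (h (l + m - int i + int t) (f (int i) w))
       + ((- 1) powi m * (- 1) powi k) \<cdot> h (l + m - int i + k - int t) (g (int t) (f (int i) w))))"
proof -
  let ?e = "nth_product k g h"
  have e: "formal_field ?e" by (rule field_nth_product[OF g h])
  obtain P where P: "\<And>n. P \<le> n \<Longrightarrow> f n w = 0" using field_bound[OF f] by blast
  obtain Q where Q: "\<And>n. Q \<le> n \<Longrightarrow> g n w = 0" using field_bound[OF g] by blast
  obtain R where R: "\<And>n. R \<le> n \<Longrightarrow> h n w = 0" using field_bound[OF h] by blast
  have "\<forall>i. ?e (l + int i) w = partial_product B k g h (l + int i) w"
    if "max (nat Q) (nat (R - l)) \<le> B" for B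
    using that by (intro allI partial_product_eq[OF g h Q R]) auto
  then have 1: "\<forall>\<^sub>F B in sequentially. \<forall>i. ?e (l + int i) w = partial_product B k g h (l + int i) w"
    unfolding eventually_sequentially by blast
  have "\<forall>\<^sub>F B in sequentially. \<forall>i\<in>{..<nat P}.
      ?e (l + m - int i) (f (int i) w) = partial_product B k g h (l + m - int i) (f (int i) w)"
    by (intro eventually_ball_finite ballI eventually_partial_product[OF g h]) auto
  then have 2: "\<forall>\<^sub>F B in sequentially. \<forall>i.
      ?e (l + m - int i) (f (int i) w) = partial_product B k g h (l + m - int i) (f (int i) w)"
  proof eventually_elim
    case (elim B)
    show ?case
    proof
      fix i
      show "?e (l + m - int i) (f (int i) w) = partial_product B k g h (l + m - int i) (f (int i) w)"
      proof (cases "i < nat P")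
        case False
        then have "f (int i) w = 0" using P by simp
        then show ?thesis using e g h by (simp add: partial_product_def)
      qed (use elim in auto)
    qed
  qed
  have "\<forall>\<^sub>F B in sequentially. nth_product m f ?e l w = partial_product B m f ?e l w"
    by (rule eventually_partial_product[OF f e])
  then show ?thesis using 1 2
  proof eventually_elim
    case (elim B)
    show ?case
      unfolding elim(1) partial_product_def[of B m] elim(2)[rule_format] elim(3)[rule_format]
      unfolding partial_product_def
      by (simp add: field_diff[OF f] field_sum[OF f] field_scale[OF f] scale_sum_right sum_subtractf
          sum.distrib scale_right_diff_distrib scale_right_distrib mult_ac)
  qed
qed

text \<open>Of the four terms in each iterated product, the two with \<open>h\<close> between \<open>f\<close> and \<open>g\<close> also occur in
  the other one, with the same expansions, and cancel.\<close>

lemma eventually_commutator_products: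
  assumes f: "formal_field f" and g: "formal_field g" and h: "formal_field h"
  shows "\<forall>\<^sub>F B in sequentially.
    nth_product m f (nth_product k g h) l w - nth_product k g (nth_product m f h) l w =
    (\<Sum>i<B. \<Sum>t<B. (alt_binomial m i * alt_binomial k t) \<cdot>
      ((f (m - int i) (g (k - int t) (h (l + int i + int t) w))
        - g (k - int t) (f (m - int i) (h (l + int i + int t) w)))
       - ((- 1) powi m * (- 1) powi k) \<cdot> h (l + m + k - int i - int t)
           (f (int i) (g (int t) w) - g (int t) (f (int i) w))))"
  using eventually_iterated_product[OF f g h, of m k l w]
    eventually_iterated_product[OF g f h, of k m l w]
proof eventually_elim
  case (elim B)
  show ?case
    unfolding elim
    by (subst (2) sum.swap, unfold sum_subtractf[symmetric] scale_right_diff_distrib[symmetric],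
      intro sum.cong refl, simp only: mult.commute[of "alt_binomial k _"])
     (simp add: algebra_simps field_diff[OF h])
qed

text \<open>This is \<open>(x - y)\<^sup>n\<^sup>+\<^sup>1 = (x - y)\<^sup>n x - (x - y)\<^sup>n y\<close>; the factor \<open>x\<close> shifts the modes of \<open>f\<close> and the
  factor \<open>y\<close> those of the product.\<close>

lemma nth_product_Suc:
  assumes f: "formal_field f" and g: "formal_field g"
  shows "nth_product (n + 1) f g k w = nth_product n (\<lambda>p. f (p + 1)) g k w - nth_product n f g (k + 1) w"
proof -
  obtain P where P: "\<And>n. P \<le> n \<Longrightarrow> f n w = 0" using field_bound[OF f] by blast
  obtain Q where Q: "\<And>n. Q \<le> n \<Longrightarrow> g n w = 0" using field_bound[OF g] by blast
  have "jacobi_lhs (\<lambda>p q. f p (g q w)) (\<lambda>q p. g q (f p w)) (0 + 1) n k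
    = nth_product n f g (k + 1) w + nth_product (n + 1) f g k w"
    unfolding nth_product_def
    by (rule jacobi_lhs_Suc[where P = P and Q = Q]) (use P Q f g in auto)
  moreover have "jacobi_lhs (\<lambda>p q. f p (g q w)) (\<lambda>q p. g q (f p w)) (0 + 1) n k
    = nth_product n (\<lambda>p. f (p + 1)) g k w"
    unfolding nth_product_def jacobi_lhs_def binomial_sum_def by (simp add: algebra_simps)
  ultimately show ?thesis by (metis add_diff_cancel_left')
qed

lemma nth_product_shift_right:
  "nth_product n f (\<lambda>p. g (p + a)) k w = nth_product n f g (k + a) w"
  unfolding nth_product_def jacobi_lhs_def binomial_sum_def by (simp add: algebra_simps)

lemma field_shift: "formal_field f \<Longrightarrow> formal_field (\<lambda>p. f (p + a))"
  using field_scale_shift[of f "\<lambda>_. 1" a] by simp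

lemma nth_product_diff_right:
  assumes f: "formal_field f" and g: "formal_field g" and h: "formal_field h"
  shows "nth_product n f (\<lambda>p w. g p w - h p w) k w = nth_product n f g k w - nth_product n f h k w"
  using nth_product_add_right[OF f g field_scale_shift[OF h, of "\<lambda>_. -1" 0], of n k w]
    nth_product_scale_right[OF f h, of n "-1" k w] by simp

text \<open>Raising the power of the difference of the two variables by one amounts to replacing
  \<open>f(x), g(y)\<close> by \<open>x f(x), g(y)\<close> and by \<open>f(x), y g(y)\<close> and subtracting, because the contributions
  of the variable of \<open>h\<close> cancel.  Hence the power is passed on to the commutator of \<open>f\<close> and \<open>g\<close>
  itself, which is the part of the formula that locality kills.\<close>

lemma eventually_difference_commutator_products:
  assumes "formal_field f" and "formal_field g" and h: "formal_field h"
  shows "\<forall>\<^sub>F B in sequentially.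
    difference_mult (\<lambda>p q. nth_product p f (nth_product q g h) l w
      - nth_product q g (nth_product p f h) l w) n m k =
    (\<Sum>i<B. \<Sum>t<B. (alt_binomial m i * alt_binomial k t) \<cdot>
      (difference_mult (\<lambda>p q. f p (g q (h (l + int i + int t) w))
          - g q (f p (h (l + int i + int t) w))) n (m - int i) (k - int t)
       - ((- 1) powi m * (- 1) powi k) \<cdot> h (l + m + k - int i - int t)
           (difference_mult (\<lambda>p q. f p (g q w) - g q (f p w)) n (int i) (int t))))"
  using assms(1,2)
proof (induction n arbitrary: f g)
  case 0
  then show ?case using eventually_commutator_products[OF 0 h, of m k l w] by simp
next
  case (Suc n)
  note f = \<open>formal_field f\<close> and g = \<open>formal_field g\<close>
  let ?Tf = "\<lambda>p. f (p + 1)" and ?Tg = "\<lambda>p. g (p + 1)"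
  note Tf = field_shift[OF f, of 1] and Tg = field_shift[OF g, of 1]
  define D where "D = (\<lambda>f g p q. nth_product p f (nth_product q g h) l w
    - nth_product q g (nth_product p f h) l w)"
  have A: "nth_product (p + 1) f (nth_product q g h) l w - nth_product p f (nth_product (q + 1) g h) l w
    = nth_product p (\<lambda>p. f (p + 1)) (nth_product q g h) l w
      - nth_product p f (nth_product q (\<lambda>p. g (p + 1)) h) l w"
    if f: "formal_field f" and g: "formal_field g" for p q f g
  proof -
    have "nth_product (q + 1) g h = (\<lambda>l w. nth_product q (\<lambda>p. g (p + 1)) h l w - nth_product q g h (l + 1) w)"
      by (intro ext nth_product_Suc g h)
    then have "nth_product p f (nth_product (q + 1) g h) l w
      = nth_product p f (nth_product q (\<lambda>p. g (p + 1)) h) l w - nth_product p f (nth_product q g h) (l + 1) w"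
      using nth_product_diff_right[OF f field_nth_product[OF field_shift[OF g, of 1] h, of q]
        field_shift[OF field_nth_product[OF g h, of q], of 1]]
      by (simp add: nth_product_shift_right)
    then show ?thesis
      by (simp add: nth_product_Suc[OF f field_nth_product[OF g h]])
  qed
  have step: "D f g (p + 1) q - D f g p (q + 1) = D ?Tf g p q - D f ?Tg p q" for p q
    using A[OF f g, of p q] A[OF g f, of q p] unfolding D_def by (simp add: algebra_simps)
  have 1: "difference_mult (D f g) (Suc n) m k = difference_mult (D ?Tf g) n m k - difference_mult (D f ?Tg) n m k"
    unfolding difference_mult_Suc'[symmetric] step by (rule difference_mult_diff)
  have 2: "difference_mult (\<lambda>p q. f p (g q u) - g q (f p u)) (Suc n) a b =
    difference_mult (\<lambda>p q. f (p + 1) (g q u) - g q (f (p + 1) u)) n a b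
    - difference_mult (\<lambda>p q. f p (g (q + 1) u) - g (q + 1) (f p u)) n a b" for a b u
    by (simp flip: difference_mult_diff difference_mult_Suc' del: difference_mult.simps)
  show ?case
    using Suc.IH[OF Tf g] Suc.IH[OF f Tg]
  proof eventually_elim
    case (elim B)
    show ?case unfolding 1[unfolded D_def] 2 elim
      by (simp add: field_diff[OF h] scale_right_diff_distrib sum_subtractf)
  qed
qed

text \<open>The order \<open>N\<close> depends only on \<open>f\<close> and \<open>g\<close>, not on the field \<open>h\<close> acted upon.\<close>

theorem weak_commutativity:
  assumes "formal_field f" "formal_field g" "local_fields f g"
  obtains N where "\<And>h l w n m k. formal_field h \<Longrightarrow> N \<le> n \<Longrightarrow>
    difference_mult (\<lambda>p q. nth_product p f (nth_product q g h) l w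
      - nth_product q g (nth_product p f h) l w) n m k = 0"
proof -
  obtain N where N: "\<And>n w p q. N \<le> n \<Longrightarrow> difference_mult (\<lambda>p q. f p (g q w) - g q (f p w)) n p q = 0"
    using local_fieldsE assms by blast
  show thesis
  proof (rule that[of N])
    fix h l w n m k assume h: "formal_field h" and n: "N \<le> n"
    have "\<forall>\<^sub>F B::nat in sequentially. difference_mult (\<lambda>p q. nth_product p f (nth_product q g h) l w
      - nth_product q g (nth_product p f h) l w) n m k = 0"
      using eventually_difference_commutator_products[OF assms(1,2) h, of l w n m k]
      by eventually_elim (simp add: N n h)
    then show "difference_mult (\<lambda>p q. nth_product p f (nth_product q g h) l w
      - nth_product q g (nth_product p f h) l w) n m k = 0" by simp
  qed
qed

section \<open>Weak associativity of the products\<close>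

text \<open>The modes of \<open>1/i! (d/dx)\<^sup>i f(x)\<close>.\<close>

definition divided_derivative :: "nat \<Rightarrow> (int \<Rightarrow> 'w \<Rightarrow> 'w) \<Rightarrow> int \<Rightarrow> 'w \<Rightarrow> 'w" where
  "divided_derivative i f k w = alt_binomial k i \<cdot> f (k - int i) w"

lemma divided_derivative_0 [simp]: "divided_derivative 0 f = f"
  by (simp add: divided_derivative_def fun_eq_iff)

lemma field_divided_derivative: "formal_field f \<Longrightarrow> formal_field (divided_derivative i f)"
  using field_scale_shift[of f "\<lambda>k. alt_binomial k i" "- int i"] by (simp add: divided_derivative_def[abs_def])

lemma derivative_divided_derivative:
  "derivative (divided_derivative i f) k w = of_nat (Suc i) \<cdot> divided_derivative (Suc i) f k w"
proof -
  have "of_nat (Suc i) \<cdot> divided_derivative (Suc i) f k w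
    = (of_nat (Suc i) * alt_binomial k (Suc i)) \<cdot> f (k - 1 - int i) w"
    by (simp add: divided_derivative_def algebra_simps)
  then show ?thesis
    unfolding alt_binomial_absorption by (simp add: derivative_def divided_derivative_def)
qed

text \<open>The Leibniz rule \<open>f\<^sub>(\<^sub>n\<^sub>) \<partial> g = \<partial> (f\<^sub>(\<^sub>n\<^sub>) g) + n f\<^sub>(\<^sub>n\<^sub>-\<^sub>1\<^sub>) g\<close>, iterated.\<close>

lemma nth_product_divided_derivative_right:
  assumes f: "formal_field f" and g: "formal_field g"
  shows "nth_product n f (divided_derivative i g) k w =
    (\<Sum>t\<le>i. (of_int n gchoose t) \<cdot> divided_derivative (i - t) (nth_product (n - int t) f g) k w)"
proof (induction i arbitrary: n k)
  case 0
  then show ?case by simp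
next
  case (Suc i)
  define G where "G = (\<lambda>t. divided_derivative (Suc i - t) (nth_product (n - int t) f g) k w)"
  note gi = field_divided_derivative[OF g, of i]
  have "of_nat (Suc i) \<cdot> nth_product n f (divided_derivative (Suc i) g) k w
      = nth_product n f (derivative (divided_derivative i g)) k w"
    using nth_product_scale_right[OF f field_divided_derivative[OF g], of n "of_nat (Suc i)" "Suc i" k w]
    by (simp only: derivative_divided_derivative[abs_def])
  also have "\<dots> = derivative (nth_product n f (divided_derivative i g)) k w
      + of_int n \<cdot> nth_product (n - 1) f (divided_derivative i g) k w"
    by (rule nth_product_derivative_right[OF f gi])
  also have "derivative (nth_product n f (divided_derivative i g)) k w
      = (\<Sum>t\<le>i. (of_int n gchoose t) \<cdot> derivative (divided_derivative (i - t) (nth_product (n - int t) f g)) k w)"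
    by (simp add: derivative_def[of "nth_product n f _"] Suc.IH scale_sum_right mult.commute)
       (simp add: derivative_def mult.commute)
  also have "\<dots> = (\<Sum>t\<le>i. (of_nat (Suc i - t) * (of_int n gchoose t)) \<cdot> G t)"
    by (intro sum.cong refl) (simp add: derivative_divided_derivative G_def Suc_diff_le mult.commute del: of_nat_Suc)
  also have "\<dots> = (\<Sum>t\<le>Suc i. (of_nat (Suc i - t) * (of_int n gchoose t)) \<cdot> G t)" by simp
  also have "of_int n \<cdot> nth_product (n - 1) f (divided_derivative i g) k w
      = (\<Sum>t\<le>i. (of_nat (Suc t) * (of_int n gchoose Suc t)) \<cdot> G (Suc t))"
    unfolding gbinomial_absorption
    by (simp add: Suc.IH scale_sum_right G_def algebra_simps)
  also have "\<dots> = (\<Sum>t\<le>Suc i. (of_nat t * (of_int n gchoose t)) \<cdot> G t)"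
    by (subst sum.atMost_Suc_shift) simp
  also have "(\<Sum>t\<le>Suc i. (of_nat (Suc i - t) * (of_int n gchoose t)) \<cdot> G t)
      + (\<Sum>t\<le>Suc i. (of_nat t * (of_int n gchoose t)) \<cdot> G t)
      = (\<Sum>t\<le>Suc i. of_nat (Suc i) \<cdot> ((of_int n gchoose t) \<cdot> G t))"
    unfolding sum.distrib[symmetric]
    by (intro sum.cong refl)
      (simp add: scale_left_distrib[symmetric] distrib_right[symmetric] of_nat_diff del: of_nat_Suc)
  also have "\<dots> = of_nat (Suc i) \<cdot> (\<Sum>t\<le>Suc i. (of_int n gchoose t) \<cdot> G t)"
    by (simp add: scale_sum_right del: sum.atMost_Suc of_nat_Suc)
  finally show ?case
    unfolding G_def by (subst (asm) scale_cancel_left) (auto simp del: of_nat_Suc)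
qed

lemma eventually_skew_symmetry:
  assumes f: "formal_field f" and g: "formal_field g" and loc: "local_fields f g"
  shows "\<forall>\<^sub>F B in sequentially. nth_product n g f l w =
    (\<Sum>i<B. (- 1) powi (n + 1 + int i) \<cdot> divided_derivative i (nth_product (n + int i) f g) l w)"
proof -
  obtain N where N: "\<And>n. N \<le> n \<Longrightarrow> nth_product n f g = (\<lambda>k w. 0)"
    using nth_product_local[OF assms] by blast
  have "nth_product n g f l w =
    (\<Sum>i<B. (- 1) powi (n + 1 + int i) \<cdot> divided_derivative i (nth_product (n + int i) f g) l w)"
    if "nat (N - n) \<le> B" for B
    unfolding skew_symmetry[OF assms]
    by (subst jacobi_rhs_lessThan[where N = N])
      (use that N in \<open>auto simp: scale_sum_right divided_derivative_def alt_binomial_def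
         power_int_add mult_ac\<close>)
  then show ?thesis unfolding eventually_sequentially by blast
qed

text \<open>After the upper indices are negated, this is the Vandermonde convolution.\<close>

lemma binomial_convolution:
  "(\<Sum>j\<le>u. alt_binomial n j * (of_int (m + n - int j) gchoose (u - j))) = (of_int m gchoose u :: 'k)"
proof -
  have "(\<Sum>j\<le>u. alt_binomial n j * (of_int (m + n - int j) gchoose (u - j)))
    = (\<Sum>j\<le>u. (- 1) ^ u * ((of_int n gchoose j) * (of_int (int u - 1 - m - n) gchoose (u - j)) :: 'k))"
  proof (intro sum.cong refl)
    fix j assume "j \<in> {..u}"
    then have j: "j \<le> u" by simp
    have "(of_int (m + n - int j) gchoose (u - j) :: 'k)
      = (- 1) ^ (u - j) * (of_int (int u - 1 - m - n) gchoose (u - j))"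
      by (subst gbinomial_negated_upper) (simp add: j of_nat_diff algebra_simps)
    moreover have "(- 1) ^ u = ((- 1) ^ j * (- 1) ^ (u - j) :: 'k)"
      using j by (simp flip: power_add)
    ultimately show "alt_binomial n j * (of_int (m + n - int j) gchoose (u - j))
      = ((- 1) ^ u * ((of_int n gchoose j) * (of_int (int u - 1 - m - n) gchoose (u - j))) :: 'k)"
      by (simp add: alt_binomial_def mult_ac)
  qed
  also have "\<dots> = (- 1) ^ u * (of_int n + of_int (int u - 1 - m - n) gchoose u)"
    unfolding sum_distrib_left[symmetric] gbinomial_Vandermonde[symmetric]
    by (simp add: atMost_atLeast0)
  also have "of_int n + of_int (int u - 1 - m - n) = (of_nat u - of_int m - 1 :: 'k)" by simp
  also have "(- 1) ^ u * (of_nat u - of_int m - 1 gchoose u) = (of_int m gchoose u :: 'k)"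
    by (rule gbinomial_negated_upper[symmetric])
  finally show ?thesis .
qed

lemma sum_square_triangle:
  fixes G :: "nat \<Rightarrow> nat \<Rightarrow> 'a::comm_monoid_add"
  assumes "\<And>j t. B \<le> j + t \<Longrightarrow> G j t = 0"
  shows "(\<Sum>j<B. \<Sum>t<B. G j t) = (\<Sum>u<B. \<Sum>j\<le>u. G j (u - j))"
proof -
  have "(\<Sum>j<B. \<Sum>t<B. G j t) = (\<Sum>(j, t)\<in>{..<B} \<times> {..<B}. G j t)"
    by (simp add: sum.cartesian_product)
  also have "\<dots> = (\<Sum>(j, t)\<in>{(j, t). j + t < B}. G j t)"
  proof (rule sum.mono_neutral_right)
    show "\<forall>x\<in>{..<B} \<times> {..<B} - {(j, t). j + t < B}. (case x of (j, t) \<Rightarrow> G j t) = 0"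
    proof
      fix x assume "x \<in> {..<B} \<times> {..<B} - {(j, t). j + t < B}"
      then show "(case x of (j, t) \<Rightarrow> G j t) = 0" using assms[of "fst x" "snd x"] by (auto simp: case_prod_beta)
    qed
  qed auto
  also have "\<dots> = (\<Sum>u<B. \<Sum>j\<le>u. G j (u - j))"
    by (rule sum.triangle_reindex)
  finally show ?thesis .
qed

text \<open>For large \<open>m\<close> the second sum on the left side of the Borcherds identity is zero.  In the first one,
  skew symmetry turns \<open>g\<^sub>(\<^sub>k\<^sub>+\<^sub>j\<^sub>) h\<close> into derivatives of \<open>h\<^sub>(\<^sub>k\<^sub>+\<^sub>j\<^sub>+\<^sub>i\<^sub>) g\<close>, and the derivatives are moved
  to the outside.  What remains is \<open>(x - z)\<^sup>m f(x) h(z)\<close> acting on \<open>g\<close>,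
  where \<open>f\<close> and \<open>h\<close> may be exchanged if \<open>m\<close> is large.  Skew symmetry for
  \<open>f\<^sub>(\<^sub>p\<^sub>) g\<close> and \<open>h\<close> then gives the right side.\<close>

theorem weak_associativity:
  assumes f: "formal_field f" and g: "formal_field g" and h: "formal_field h"
    and fh: "local_fields f h" and gh: "local_fields g h"
    and fgh: "\<And>n. local_fields (nth_product n f g) h"
  obtains M where "\<And>m n k l w. M \<le> m \<Longrightarrow>
    jacobi_rhs (\<lambda>p q. nth_product q (nth_product p f g) h l w) m n k =
    jacobi_lhs (\<lambda>p q. nth_product p f (nth_product q g h) l w)
      (\<lambda>q p. nth_product q g (nth_product p f h) l w) m n k"
proof -
  obtain N where N: "\<And>n. N \<le> n \<Longrightarrow> nth_product n f h = (\<lambda>k w. 0)"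
    using nth_product_local[OF f h fh] by blast
  obtain Q where Q: "\<And>n. Q \<le> n \<Longrightarrow> nth_product n g h = (\<lambda>k w. 0)"
    using nth_product_local[OF g h gh] by blast
  note hg = local_fields_sym[OF gh]
  obtain Q' where Q': "\<And>n. Q' \<le> n \<Longrightarrow> nth_product n h g = (\<lambda>k w. 0)"
    using nth_product_local[OF h g hg] by blast
  obtain C where C: "\<And>l w n m k. C \<le> n \<Longrightarrow>
    difference_mult (\<lambda>p q. nth_product p f (nth_product q h g) l w
      - nth_product q h (nth_product p f g) l w) n m k = 0"
  proof (rule weak_commutativity[OF f h fh])
    fix N assume N: "\<And>u l w n m k. formal_field u \<Longrightarrow> N \<le> n \<Longrightarrow>
      difference_mult (\<lambda>p q. nth_product p f (nth_product q h u) l w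
        - nth_product q h (nth_product p f u) l w) n m k = 0"
    show thesis by (rule that[of N], rule N[OF g])
  qed
  show thesis
  proof (rule that[of "max N (int C)"])
    fix m n k l w assume "max N (int C) \<le> m"
    then have "N \<le> m" "int C \<le> m" by auto
    define a where "a = nat m"
    have a: "m = int a" "C \<le> a" using \<open>int C \<le> m\<close> by (auto simp: a_def)
    let ?s = "\<lambda>x::int. (- 1) powi x :: 'k"
    have s: "?s (x + int u) = (- 1) ^ u * ?s x" for x u
      by (simp add: power_int_add)
    define P where "P = (\<lambda>p q. nth_product p f (nth_product q h g))"
    define E where "E = (\<lambda>u i. ?s (k + 1 + int u + int i) \<cdot>
       divided_derivative i (P (m + n - int u) (k + int u + int i)) l w)"
    have Pz: "P p q = (\<lambda>k w. 0)" if "Q' \<le> q" for p q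
      unfolding P_def Q'[OF that] using nth_product_zero_right[OF f] by (simp add: fun_eq_iff)
    have "\<forall>\<^sub>F B in sequentially. \<forall>u\<in>{..a}.
      nth_product (k + int u) (nth_product (n + m - int u) f g) h l w =
        (\<Sum>i<B. (- 1) powi (k + int u + 1 + int i) \<cdot>
          divided_derivative i (nth_product (k + int u + int i) h (nth_product (n + m - int u) f g)) l w)"
      by (intro eventually_ball_finite ballI eventually_skew_symmetry h field_nth_product f g
         local_fields_sym[OF fgh]) auto
    moreover have "\<forall>\<^sub>F B in sequentially. max a (max (nat (Q - k)) (nat (Q' - k))) < B"
      by (rule eventually_gt_at_top)
    ultimately have "\<forall>\<^sub>F B in sequentially.
      jacobi_rhs (\<lambda>p q. nth_product q (nth_product p f g) h l w) m n k =
      jacobi_lhs (\<lambda>p q. nth_product p f (nth_product q g h) l w)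
        (\<lambda>q p. nth_product q g (nth_product p f h) l w) m n k"
    proof eventually_elim
      case (elim B)
      note skew = elim(1)[rule_format]
      have aB: "a < B" and QB: "nat (Q - k) \<le> B" and QB': "Q' \<le> k + int B" using elim(2) by auto
      have "jacobi_lhs (\<lambda>p q. nth_product p f (nth_product q g h) l w)
        (\<lambda>q p. nth_product q g (nth_product p f h) l w) m n k
        = binomial_sum (\<lambda>p q. nth_product p f (nth_product q g h) l w) m n k"
      proof -
        have "nth_product (m + int j) f h = (\<lambda>k w. 0)" for j
          by (rule N) (use \<open>N \<le> m\<close> in simp)
        then show ?thesis
          unfolding jacobi_lhs_def binomial_sum_def[of "\<lambda>q p. nth_product q g (nth_product p f h) l w"]
          using nth_product_zero_right[OF g] by simp
      qed
      also have "\<dots> = (\<Sum>j<B. alt_binomial n j \<cdot> nth_product (m + n - int j) f (nth_product (k + int j) g h) l w)"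
        by (rule binomial_sum_lessThan[where Q = Q]) (use Q QB nth_product_zero_right[OF f] in auto)
      \<comment> \<open>skew symmetry for \<open>g\<close> and \<open>h\<close>, then the Leibniz rule, in which \<open>t\<close> derivatives lower the index of \<open>f\<close>\<close>
      also have "\<dots> = (\<Sum>j<B. \<Sum>i<B. \<Sum>t<B. (alt_binomial n j * (of_int (m + n - int j) gchoose t)) \<cdot> E (j + t) i)"
      proof (intro sum.cong refl)
        fix j
        have E0: "E u i = 0" if "B \<le> u + i" for u i
          using Pz[of "k + int u + int i"] that QB' by (simp add: E_def divided_derivative_def)
        have "nth_product (k + int j) g h = (\<lambda>l w. \<Sum>i<B. ?s (k + int j + 1 + int i) \<cdot>
            divided_derivative i (nth_product (k + int j + int i) h g) l w)"
        proof (intro ext)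
          fix l w
          show "nth_product (k + int j) g h l w = (\<Sum>i<B. ?s (k + int j + 1 + int i) \<cdot>
            divided_derivative i (nth_product (k + int j + int i) h g) l w)"
            unfolding skew_symmetry[OF h g hg, of "k + int j"]
            by (subst jacobi_rhs_lessThan[where N = Q' and B = B])
              (use Q' QB' in \<open>auto simp: scale_sum_right divided_derivative_def alt_binomial_def
                  power_int_add mult_ac\<close>)
        qed
        then have "nth_product (m + n - int j) f (nth_product (k + int j) g h) l w
          = (\<Sum>i<B. ?s (k + int j + 1 + int i) \<cdot> nth_product (m + n - int j) f
              (divided_derivative i (nth_product (k + int j + int i) h g)) l w)"
          using nth_product_sum_right[OF f, of "{..<B}" "\<lambda>i l w. ?s (k + int j + 1 + int i) \<cdot>
            divided_derivative i (nth_product (k + int j + int i) h g) l w" "m + n - int j" l w]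
            field_scale_shift[OF field_divided_derivative[OF field_nth_product[OF h g]], where a = 0]
          by (simp add: nth_product_scale_right[OF f field_divided_derivative[OF field_nth_product[OF h g]]])
        also have "\<dots> = (\<Sum>i<B. \<Sum>t\<le>i. (of_int (m + n - int j) gchoose t) \<cdot> E (j + t) (i - t))"
          unfolding nth_product_divided_derivative_right[OF f field_nth_product[OF h g]] scale_sum_right E_def P_def
          by (intro sum.cong refl) (simp add: algebra_simps of_nat_diff)
        also have "\<dots> = (\<Sum>t<B. \<Sum>i<B. (of_int (m + n - int j) gchoose t) \<cdot> E (j + t) i)"
          by (rule sum_square_triangle[symmetric]) (use E0 in simp)
        finally show "alt_binomial n j \<cdot> nth_product (m + n - int j) f (nth_product (k + int j) g h) l w
          = (\<Sum>i<B. \<Sum>t<B. (alt_binomial n j * (of_int (m + n - int j) gchoose t)) \<cdot> E (j + t) i)"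
          by (subst sum.swap) (simp add: scale_sum_right)
      qed
      also have "\<dots> = (\<Sum>i<B. \<Sum>j<B. \<Sum>t<B. (alt_binomial n j * (of_int (m + n - int j) gchoose t)) \<cdot> E (j + t) i)"
        by (rule sum.swap)
      \<comment> \<open>collect the terms with \<open>j + t = u\<close>\<close>
      also have "\<dots> = (\<Sum>i<B. \<Sum>u<B. (of_int m gchoose u) \<cdot> E u i)"
      proof (rule sum.cong[OF refl])
        fix i
        have E0: "E u i = 0" if "B \<le> u" for u
          using Pz[of "k + int u + int i"] that QB' by (simp add: E_def divided_derivative_def)
        have "(\<Sum>j<B. \<Sum>t<B. (alt_binomial n j * (of_int (m + n - int j) gchoose t)) \<cdot> E (j + t) i)
          = (\<Sum>u<B. \<Sum>j\<le>u. (alt_binomial n j * (of_int (m + n - int j) gchoose (u - j))) \<cdot> E (j + (u - j)) i)"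
          by (rule sum_square_triangle) (use E0 in simp)
        also have "\<dots> = (\<Sum>u<B. (of_int m gchoose u) \<cdot> E u i)"
          unfolding binomial_convolution[where m = m and n = n, symmetric] scale_sum_left by (intro sum.cong refl) simp
        finally show "(\<Sum>j<B. \<Sum>t<B. (alt_binomial n j * (of_int (m + n - int j) gchoose t)) \<cdot> E (j + t) i)
          = (\<Sum>u<B. (of_int m gchoose u) \<cdot> E u i)" .
      qed
      also have "\<dots> = (\<Sum>i<B. \<Sum>u\<le>a. (of_int m gchoose u) \<cdot>
          (?s (k + 1 + int u + int i) \<cdot> divided_derivative i
            (nth_product (k + int u + int i) h (nth_product (n + m - int u) f g)) l w))"
      proof (rule sum.cong[OF refl])
        fix i
        \<comment> \<open>\<open>f\<close> and \<open>h\<close> are exchanged inside the \<open>a\<close>-th difference, where \<open>m = a\<close>\<close>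
        define c where "c = ?s (k + 1 + int i) * alt_binomial l i"
        define X where "X = (\<lambda>p q. nth_product p f (nth_product q h g) (l - int i) w)"
        define Y where "Y = (\<lambda>p q. nth_product q h (nth_product p f g) (l - int i) w)"
        have XY: "difference_mult X a n (k + int i) = difference_mult Y a n (k + int i)"
          using C[OF a(2), of "l - int i" w n "k + int i"]
          unfolding difference_mult_diff X_def Y_def by simp
        have coeff: "(of_int m gchoose u) * (?s (k + 1 + int u + int i) * alt_binomial l i)
          = c * alt_binomial (int a) u" for u
        proof -
          have "k + 1 + int u + int i = k + 1 + int i + int u" by simp
          then show ?thesis unfolding c_def a alt_binomial_def s by (simp only: mult_ac s)
        qed
        have "(\<Sum>u<B. (of_int m gchoose u) \<cdot> E u i) = (\<Sum>u\<le>a. (of_int m gchoose u) \<cdot> E u i)"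
          by (rule sum.mono_neutral_right)
            (use aB in \<open>auto simp: a not_le simp flip: binomial_gbinomial\<close>)
        also have "\<dots> = c \<cdot> difference_mult X a n (k + int i)"
          unfolding difference_mult_closed_form scale_sum_right
          by (intro sum.cong refl)
            (simp add: E_def P_def divided_derivative_def X_def coeff, simp add: a algebra_simps)
        also have "\<dots> = (\<Sum>u\<le>a. (of_int m gchoose u) \<cdot>
          (?s (k + 1 + int u + int i) \<cdot> divided_derivative i
            (nth_product (k + int u + int i) h (nth_product (n + m - int u) f g)) l w))"
          unfolding XY
          unfolding difference_mult_closed_form scale_sum_right
          by (intro sum.cong refl)
            (simp add: divided_derivative_def Y_def coeff, simp add: a algebra_simps)
        finally show "(\<Sum>u<B. (of_int m gchoose u) \<cdot> E u i) = (\<Sum>u\<le>a. (of_int m gchoose u) \<cdot>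
          (?s (k + 1 + int u + int i) \<cdot> divided_derivative i
            (nth_product (k + int u + int i) h (nth_product (n + m - int u) f g)) l w))" .
      qed
      also have "\<dots> = (\<Sum>u\<le>a. (of_int m gchoose u) \<cdot>
          nth_product (k + int u) (nth_product (n + m - int u) f g) h l w)"
      proof (subst sum.swap, intro sum.cong refl)
        fix u assume "u \<in> {..a}"
        then show "(\<Sum>i<B. (of_int m gchoose u) \<cdot> (?s (k + 1 + int u + int i) \<cdot> divided_derivative i
            (nth_product (k + int u + int i) h (nth_product (n + m - int u) f g)) l w))
          = (of_int m gchoose u) \<cdot> nth_product (k + int u) (nth_product (n + m - int u) f g) h l w"
          by (simp only: skew scale_sum_right add.assoc add.commute[of "int u" 1])
      qed
      also have "\<dots> = (\<Sum>u\<le>a. (of_int m gchoose u) \<cdot>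
          nth_product (m + k - int u) (nth_product (n + int u) f g) h l w)"
      proof (rule sum.reindex_bij_witness[of _ "\<lambda>u. a - u" "\<lambda>u. a - u"])
        fix u assume "u \<in> {..a}"
        then have u: "u \<le> a" by simp
        have "(of_int m gchoose (a - u)) = (of_int m gchoose u :: 'k)"
          using gbinomial_of_nat_symmetric[OF u, where 'a = 'k] by (simp add: a)
        moreover have "m + k - int (a - u) = k + int u" "n + int (a - u) = n + m - int u"
          using u by (auto simp: a of_nat_diff)
        ultimately show "(of_int m gchoose (a - u)) \<cdot>
            nth_product (m + k - int (a - u)) (nth_product (n + int (a - u)) f g) h l w
          = (of_int m gchoose u) \<cdot> nth_product (k + int u) (nth_product (n + m - int u) f g) h l w"
          by (simp only:)
      qed auto
      also have "\<dots> = jacobi_rhs (\<lambda>p q. nth_product q (nth_product p f g) h l w) m n k"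
        unfolding jacobi_rhs_def
        by (subst Sum_any_lessThan[of "Suc a"])
          (auto simp: a lessThan_Suc_atMost simp flip: binomial_gbinomial)
      finally show ?case ..
    qed
    then show "jacobi_rhs (\<lambda>p q. nth_product q (nth_product p f g) h l w) m n k =
      jacobi_lhs (\<lambda>p q. nth_product p f (nth_product q g h) l w)
        (\<lambda>q p. nth_product q g (nth_product p f h) l w) m n k" by simp
  qed
qed

text \<open>Weak commutativity is the identity for large \<open>n\<close> and weak associativity is the identity for large
  \<open>m\<close>; the recursion does the rest.\<close>

theorem borcherds_identity_products:
  assumes f: "formal_field f" and g: "formal_field g" and h: "formal_field h"
    and fg: "local_fields f g" and fh: "local_fields f h" and gh: "local_fields g h"
    and fgh: "\<And>n. local_fields (nth_product n f g) h"
  shows "jacobi_rhs (\<lambda>p q. nth_product q (nth_product p f g) h l w) m n k =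
    jacobi_lhs (\<lambda>p q. nth_product p f (nth_product q g h) l w)
      (\<lambda>q p. nth_product q g (nth_product p f h) l w) m n k"
proof -
  let ?X = "\<lambda>p q. nth_product p f (nth_product q g h) l w"
  let ?Y = "\<lambda>q p. nth_product q g (nth_product p f h) l w"
  let ?Z = "\<lambda>p q. nth_product q (nth_product p f g) h l w"
  obtain R where "\<And>n. R \<le> n \<Longrightarrow> nth_product n f g = (\<lambda>k w. 0)"
    using nth_product_local[OF f g fg] by blast
  then have Z: "?Z p q = 0" if "R \<le> p" for p q
    using that nth_product_zero_left[OF h] by simp
  obtain P where "\<And>n. P \<le> n \<Longrightarrow> nth_product n f h = (\<lambda>k w. 0)"
    using nth_product_local[OF f h fh] by blast
  then have Y: "?Y q p = 0" if "P \<le> p" for p q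
    using that nth_product_zero_right[OF g] by simp
  obtain Q where "\<And>n. Q \<le> n \<Longrightarrow> nth_product n g h = (\<lambda>k w. 0)"
    using nth_product_local[OF g h gh] by blast
  then have X: "?X p q = 0" if "Q \<le> q" for p q
    using that nth_product_zero_right[OF f] by simp
  obtain C where C: "\<And>n m k. C \<le> n \<Longrightarrow> difference_mult (\<lambda>p q. ?X p q - ?Y q p) n m k = 0"
  proof (rule weak_commutativity[OF f g fg])
    fix N assume N: "\<And>u l w n m k. formal_field u \<Longrightarrow> N \<le> n \<Longrightarrow>
      difference_mult (\<lambda>p q. nth_product p f (nth_product q g u) l w
        - nth_product q g (nth_product p f u) l w) n m k = 0"
    show thesis by (rule that[of N], rule N[OF h])
  qed
  obtain M where M: "\<And>m n k. M \<le> m \<Longrightarrow> jacobi_rhs ?Z m n k = jacobi_lhs ?X ?Y m n k"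
  proof (rule weak_associativity[OF f g h fh gh fgh])
    fix M assume M: "\<And>m n k l w. M \<le> m \<Longrightarrow>
      jacobi_rhs (\<lambda>p q. nth_product q (nth_product p f g) h l w) m n k =
      jacobi_lhs (\<lambda>p q. nth_product p f (nth_product q g h) l w)
        (\<lambda>q p. nth_product q g (nth_product p f h) l w) m n k"
    show thesis by (rule that[of M], rule M)
  qed
  define D where "D = (\<lambda>m n k. jacobi_rhs ?Z m n k - jacobi_lhs ?X ?Y m n k)"
  have "D m n k = 0"
  proof (rule pascal_recursion_zero[of D "max R (int C)" M])
    show "D (m + 1) n k = D m n (k + 1) + D m (n + 1) k" for m n k
      unfolding D_def
      by (simp add: jacobi_rhs_Suc[where N = R and Z = ?Z, OF Z]
          jacobi_lhs_Suc[where Q = Q and P = P and X = ?X and Y = ?Y, OF X Y])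
    show "D m n k = 0" if n: "max R (int C) \<le> n" for m n k
    proof -
      have "jacobi_rhs ?Z m n k = 0"
        unfolding jacobi_rhs_def using n Z by simp
      moreover have "jacobi_lhs ?X ?Y m (int (nat n)) k = 0"
        by (subst jacobi_lhs_of_nat[where Q = Q and P = P]) (use X Y n C in auto)
      ultimately show ?thesis using n by (simp add: D_def)
    qed
    show "D m n k = 0" if "M \<le> m" for m n k
      using M[OF that] by (simp add: D_def)
  qed
  then show ?thesis by (simp add: D_def)
qed

end

section \<open>Components of toroidal fields\<close>

text \<open>The modes of the field in \<open>x\<^sub>0\<close> that is the coefficient of \<open>x\<^sup>p\<close>.\<close>

definition component :: "('r::finite, 'w) opseries \<Rightarrow> int ^ 'r \<Rightarrow> int \<Rightarrow> 'w \<Rightarrow> 'w" where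
  "component a p n w = a w (- n - 1, p)"

lemma opseries_component: "a w (d, p) = component a p (- d - 1) w"
  by (simp add: component_def)

lemma opseries_eqI:
  assumes "\<And>p n w. component a p n w = component b p n w"
  shows "a = b"
  using assms by (auto simp: fun_eq_iff opseries_component)

lemma binom_coeff_minus_one:
  "binom_coeff (- 1) n a b = (if 0 \<le> b \<and> a + b = n then alt_binomial n (nat b) else 0)"
  by (simp add: binom_coeff_def alt_binomial_def)

lemma alt_binomial_nat: "(alt_binomial (int n) j :: 'k::field_char_0) = (- 1) ^ j * of_nat (n choose j)"
  by (simp add: alt_binomial_def binomial_gbinomial)

section \<open>The formal Jacobi identity as a Borcherds identity\<close>

locale complex_vector_space = char0_vector_space scale
  for scale :: "complex \<Rightarrow> 'w::ab_group_add \<Rightarrow> 'w" (infixr \<open>\<cdot>\<close> 75)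
begin

lemma series_mult_Sum_any:
  fixes \<phi> :: "nat \<Rightarrow> 'e::ab_group_add"
  assumes "inj \<phi>" and "\<And>J. f J \<noteq> 0 \<Longrightarrow> g (K - J) \<noteq> 0 \<Longrightarrow> J \<in> range \<phi>"
  shows "series_mult scale f g K = Sum_any (\<lambda>t. f (\<phi> t) \<cdot> g (K - \<phi> t))"
proof -
  have "{J. f J \<noteq> 0 \<and> g (K - J) \<noteq> 0} = \<phi> ` {t. f (\<phi> t) \<cdot> g (K - \<phi> t) \<noteq> 0}"
    using assms(2) by auto
  then show ?thesis
    unfolding series_mult_def Sum_any.expand_set
    using sum.reindex[of \<phi> "{t. f (\<phi> t) \<cdot> g (K - \<phi> t) \<noteq> 0}" "\<lambda>J. f J \<cdot> g (K - J)"]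
      inj_on_subset[OF assms(1), of "{t. f (\<phi> t) \<cdot> g (K - \<phi> t) \<noteq> 0}"]
    by simp
qed

text \<open>The coefficient at \<open>x\<^sub>0\<^sup>A y\<^sub>0\<^sup>B z\<^sub>0\<^sup>C\<close> of each of the three delta function terms is one of the sums
  of the Borcherds identity with exponents \<open>m = - A - 1\<close>, \<open>n = - C - 1\<close> and \<open>k = - B - 1\<close>.\<close>

lemma series_mult_delta_lhs:
  fixes P Q :: "'e::ab_group_add"
  shows "series_mult scale (\<lambda>(a, b, c, p, q). if p = 0 \<and> q = 0 then delta_coeff 1 a b c else 0)
     (\<lambda>(a, b, c, p, q). if c = 0 then H a b p q else 0) (A, B, C, P, Q)
   = binomial_sum (\<lambda>m n. H (- m - 1) (- n - 1) P Q) (- A - 1) (- C - 1) (- B - 1)"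
proof (subst series_mult_Sum_any[where \<phi> = "\<lambda>j. (- C - 1 - int j, int j, C, 0, 0)"])
  fix J :: "int \<times> int \<times> int \<times> 'e \<times> 'e"
  assume "(case J of (a, b, c, p, q) \<Rightarrow> if p = 0 \<and> q = 0 then delta_coeff 1 a b c else 0) \<noteq> 0"
    and "(case (A, B, C, P, Q) - J of (a, b, c, p, q) \<Rightarrow> if c = 0 then H a b p q else 0) \<noteq> 0"
  then show "J \<in> range (\<lambda>j. (- C - 1 - int j, int j, C, 0, 0))"
    by (cases J) (auto simp: delta_coeff_def binom_coeff_minus_one image_iff split: if_splits
        intro!: exI[of _ "nat (fst (snd J))"])
next
  show "Sum_any (\<lambda>j. (case (- C - 1 - int j, int j, C, 0, 0) of
      (a, b, c, p, q) \<Rightarrow> if p = 0 \<and> q = 0 then delta_coeff 1 a b c else 0) \<cdot>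
      (case (A, B, C, P, Q) - (- C - 1 - int j, int j, C, 0, 0) of
        (a, b, c, p, q) \<Rightarrow> if c = 0 then H a b p q else 0))
    = binomial_sum (\<lambda>m n. H (- m - 1) (- n - 1) P Q) (- A - 1) (- C - 1) (- B - 1)"
    unfolding binomial_sum_def
    by (rule Sum_any.cong) (simp add: delta_coeff_def binom_coeff_minus_one algebra_simps)
qed (auto simp: inj_on_def)

lemma series_mult_delta_lhs_swapped:
  fixes P Q :: "'e::ab_group_add"
  shows "series_mult scale (\<lambda>(a, b, c, p, q). if p = 0 \<and> q = 0 then delta_coeff (- 1) b a c else 0)
     (\<lambda>(a, b, c, p, q). if c = 0 then H a b p q else 0) (A, B, C, P, Q)
   = (- 1) powi (- C - 1) \<cdot> binomial_sum (\<lambda>n m. H (- m - 1) (- n - 1) P Q) (- B - 1) (- C - 1) (- A - 1)"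
proof (subst series_mult_Sum_any[where \<phi> = "\<lambda>j. (int j, - C - 1 - int j, C, 0, 0)"])
  fix J :: "int \<times> int \<times> int \<times> 'e \<times> 'e"
  assume "(case J of (a, b, c, p, q) \<Rightarrow> if p = 0 \<and> q = 0 then delta_coeff (- 1) b a c else 0) \<noteq> 0"
    and "(case (A, B, C, P, Q) - J of (a, b, c, p, q) \<Rightarrow> if c = 0 then H a b p q else 0) \<noteq> 0"
  then show "J \<in> range (\<lambda>j. (int j, - C - 1 - int j, C, 0, 0))"
    by (cases J) (auto simp: delta_coeff_def binom_coeff_minus_one image_iff split: if_splits
        intro!: exI[of _ "nat (fst J)"])
next
  have sign: "(- 1) powi (C + 1) = ((- 1) powi (- C - 1) :: complex)"
    by (metis (no_types) minus_add_distrib power_int_minus_one_minus uminus_add_conv_diff add.commute)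
  have scale: "Sum_any (\<lambda>j. (- 1) powi (C + 1) \<cdot> x j) = (- 1) powi (C + 1) \<cdot> Sum_any x"
    for x :: "nat \<Rightarrow> 'w"
  proof -
    have "{j. (- 1) powi (C + 1) \<cdot> x j \<noteq> 0} = {j. x j \<noteq> 0}" by auto
    then show ?thesis unfolding Sum_any.expand_set by (simp add: scale_sum_right)
  qed
  show "Sum_any (\<lambda>j. (case (int j, - C - 1 - int j, C, 0, 0) of
      (a, b, c, p, q) \<Rightarrow> if p = 0 \<and> q = 0 then delta_coeff (- 1) b a c else 0) \<cdot>
      (case (A, B, C, P, Q) - (int j, - C - 1 - int j, C, 0, 0) of
        (a, b, c, p, q) \<Rightarrow> if c = 0 then H a b p q else 0))
    = (- 1) powi (- C - 1) \<cdot> binomial_sum (\<lambda>n m. H (- m - 1) (- n - 1) P Q) (- B - 1) (- C - 1) (- A - 1)"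
    unfolding binomial_sum_def sign[symmetric] scale[symmetric]
    by (rule Sum_any.cong) (simp add: delta_coeff_def binom_coeff_minus_one algebra_simps)
qed (auto simp: inj_on_def)

lemma series_mult_delta_rhs:
  fixes P Q :: "'e::ab_group_add"
  shows "series_mult scale (\<lambda>(a, b, c, p, q). if p = 0 \<and> q = 0 then delta_coeff 1 a c b else 0)
     (\<lambda>(a, b, c, p, q). if a = 0 then H c b p q else 0) (A, B, C, P, Q)
   = jacobi_rhs (\<lambda>m n. H (- m - 1) (- n - 1) P Q) (- A - 1) (- C - 1) (- B - 1)"
proof (subst series_mult_Sum_any[where \<phi> = "\<lambda>j. (A, - A - 1 - int j, int j, 0, 0)"])
  fix J :: "int \<times> int \<times> int \<times> 'e \<times> 'e"
  assume "(case J of (a, b, c, p, q) \<Rightarrow> if p = 0 \<and> q = 0 then delta_coeff 1 a c b else 0) \<noteq> 0"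
    and "(case (A, B, C, P, Q) - J of (a, b, c, p, q) \<Rightarrow> if a = 0 then H c b p q else 0) \<noteq> 0"
  then show "J \<in> range (\<lambda>j. (A, - A - 1 - int j, int j, 0, 0))"
    by (cases J) (auto simp: delta_coeff_def binom_coeff_minus_one image_iff split: if_splits
        intro!: exI[of _ "nat (fst (snd (snd J)))"])
next
  have coeff: "(alt_binomial (A + int j) j :: complex) = (of_int (- A - 1) gchoose j)" for j
    by (simp add: alt_binomial_eq)
  show "Sum_any (\<lambda>j. (case (A, - A - 1 - int j, int j, 0, 0) of
      (a, b, c, p, q) \<Rightarrow> if p = 0 \<and> q = 0 then delta_coeff 1 a c b else 0) \<cdot>
      (case (A, B, C, P, Q) - (A, - A - 1 - int j, int j, 0, 0) of
        (a, b, c, p, q) \<Rightarrow> if a = 0 then H c b p q else 0))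
    = jacobi_rhs (\<lambda>m n. H (- m - 1) (- n - 1) P Q) (- A - 1) (- C - 1) (- B - 1)"
    unfolding jacobi_rhs_def coeff[symmetric]
    by (rule Sum_any.cong) (simp add: delta_coeff_def binom_coeff_minus_one algebra_simps)
qed (auto simp: inj_on_def)

lemma jacobiI:
  assumes "\<And>u v w m n k p q. u \<in> V \<Longrightarrow> v \<in> V \<Longrightarrow> w \<in> W \<Longrightarrow>
    jacobi_lhs (\<lambda>i j. YW u (YW v w (- j - 1, q - p)) (- i - 1, p))
      (\<lambda>j i. YW v (YW u w (- i - 1, p)) (- j - 1, q - p)) m n k =
    jacobi_rhs (\<lambda>i j. YW (Y u v (- i - 1, p)) w (- j - 1, q)) m n k"
  shows "jacobi V Y scale W YW"
  unfolding jacobi_def fun_eq_iff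
proof (intro ballI allI)
  fix u v w and x :: "int \<times> int \<times> int \<times> (int ^ 'b) \<times> (int ^ 'b)"
  assume uvw: "u \<in> V" "v \<in> V" "w \<in> W"
  obtain A B C P Q where x: "x = (A, B, C, P, Q)" by (cases x) auto
  show "(series_mult scale
       (\<lambda>(a, b, c, p, q). if p = 0 \<and> q = 0 then delta_coeff 1 a b c else 0)
       (\<lambda>(a, b, c, p, q). if c = 0 then YW u (YW v w (b, q - p)) (a, p) else 0)
   - series_mult scale
       (\<lambda>(a, b, c, p, q). if p = 0 \<and> q = 0 then delta_coeff (- 1) b a c else 0)
       (\<lambda>(a, b, c, p, q). if c = 0 then YW v (YW u w (a, p)) (b, q - p) else 0)) x
   = series_mult scale
       (\<lambda>(a, b, c, p, q). if p = 0 \<and> q = 0 then delta_coeff 1 a c b else 0)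
       (\<lambda>(a, b, c, p, q). if a = 0 then YW (Y u v (c, p)) w (b, q) else 0) x"
    using assms[OF uvw, where m = "- A - 1" and n = "- C - 1" and k = "- B - 1" and p = P and q = Q]
    unfolding x minus_apply series_mult_delta_lhs[where H = "\<lambda>a b p q. YW u (YW v w (b, q - p)) (a, p)"]
      series_mult_delta_lhs_swapped[where H = "\<lambda>a b p q. YW v (YW u w (a, p)) (b, q - p)"]
      series_mult_delta_rhs[where H = "\<lambda>c b p q. YW (Y u v (c, p)) w (b, q)"] jacobi_lhs_def .
qed

section \<open>The products of the space of toroidal fields\<close>

lemma diff_power_mult_eq:
  fixes m n :: "int ^ 'r::finite"
  shows "diff_power_mult scale k G (i, j, m, n)
   = difference_mult (\<lambda>p q. G (- p - 1, - q - 1, m, n)) k (- i - 1) (- j - 1)"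
proof -
  define \<phi> :: "nat \<Rightarrow> int \<times> int \<times> (int ^ 'r) \<times> (int ^ 'r)"
    where "\<phi> = (\<lambda>t. (int k - int t, int t, 0, 0))"
  have "diff_power_mult scale k G (i, j, m, n) = Sum_any (\<lambda>t.
      (case \<phi> t of
        (i, j, m, n) \<Rightarrow> if m = 0 \<and> n = 0 then binom_coeff (- 1) (int k) i j else 0) \<cdot>
      G ((i, j, m, n) - \<phi> t))"
    unfolding diff_power_mult_def
  proof (rule series_mult_Sum_any)
    fix J :: "int \<times> int \<times> (int ^ 'r) \<times> (int ^ 'r)"
    assume "(case J of (i, j, m, n) \<Rightarrow> if m = 0 \<and> n = 0 then binom_coeff (- 1) (int k) i j else 0) \<noteq> 0"
    then show "J \<in> range \<phi>"
      by (cases J) (auto simp: \<phi>_def binom_coeff_minus_one image_iff split: if_splits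
        intro!: exI[of _ "nat (fst (snd J))"])
  qed (auto simp: inj_on_def \<phi>_def)
  also have "\<dots> = Sum_any (\<lambda>t. alt_binomial (int k) t \<cdot> G (i - int k + int t, j - int t, m, n))"
    by (rule Sum_any.cong) (simp add: \<phi>_def binom_coeff_minus_one algebra_simps)
  also have "\<dots> = (\<Sum>t<Suc k. alt_binomial (int k) t \<cdot> G (i - int k + int t, j - int t, m, n))"
    by (rule Sum_any_lessThan) (simp add: alt_binomial_nat)
  also have "\<dots> = difference_mult (\<lambda>p q. G (- p - 1, - q - 1, m, n)) k (- i - 1) (- j - 1)"
    unfolding difference_mult_closed_form by (simp add: lessThan_Suc_atMost algebra_simps)
  finally show ?thesis .
qed

text \<open>For a series \<open>F(x, y)\<close> with powers of \<open>x\<close> and of \<open>y\<close> bounded below, the coefficient of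
  \<open>z\<^sup>-\<^sup>n\<^sup>-\<^sup>1\<close> in \<open>F(y + z, y)\<close> is the residue in \<open>x\<close> of \<open>F\<close> times the difference of the two expansions of
  \<open>(x - y)\<^sup>n\<close>.  On a monomial \<open>x\<^sup>i\<close> and for \<open>n < 0\<close> this says that the difference of the expansions has residue
  \<open>(i choose - n - 1) y\<^sup>i\<^sup>+\<^sup>n\<^sup>+\<^sup>1\<close>: the first expansion contributes for \<open>i \<ge> - n - 1\<close>, the second one
  for \<open>i < 0\<close>, and in between the binomial coefficient is zero.\<close>

lemma residue_substitution:
  assumes left: "\<And>p q. N \<le> p \<Longrightarrow> F p q = 0" and right: "\<And>p q. N \<le> q \<Longrightarrow> F p q = 0"
  shows "subst_coeff scale (\<lambda>i j. F (- i - 1) (- j - 1)) (- l - 1) (- n - 1)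
    = jacobi_lhs F (\<lambda>q p. F p q) 0 n l"
proof (cases "0 \<le> n")
  case True
  have "subst_coeff scale (\<lambda>i j. F (- i - 1) (- j - 1)) (- l - 1) (- n - 1) = 0"
    using True by (simp add: subst_coeff_def binom_coeff_def)
  moreover have "jacobi_lhs F (\<lambda>q p. F p q) 0 (int (nat n)) l = 0"
    by (subst jacobi_lhs_of_nat[where Q = N and P = N]) (use left right in \<open>auto simp: difference_mult_zero\<close>)
  ultimately show ?thesis using True by simp
next
  case False
  define e where "e = nat (- n - 1)"
  have n: "n = - 1 - int e" using False by (simp add: e_def)
  define T where "T = (\<lambda>p::int. (of_int (- p - 1) gchoose e) \<cdot> F p (l + n - p))"
  define \<phi> where "\<phi> = (\<lambda>p. (- p - 1, - (l + n - p) - 1))"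
  define B where "B = nat (max N (max (N - l) (\<bar>l\<bar> + \<bar>n\<bar> + \<bar>N\<bar>))) + 1"
  \<comment> \<open>the monomial \<open>x\<^sup>i\<close> corresponds to the mode \<open>p = - i - 1\<close>\<close>
  have set: "{(i, j). binom_coeff 1 i (- l - 1 - j) (- n - 1) \<noteq> 0 \<and> F (- i - 1) (- j - 1) \<noteq> 0}
    = \<phi> ` {p. T p \<noteq> 0}"
  proof (intro equalityI subsetI)
    fix x assume "x \<in> {(i, j). binom_coeff 1 i (- l - 1 - j) (- n - 1) \<noteq> 0 \<and> F (- i - 1) (- j - 1) \<noteq> 0}"
    then obtain i j where x: "x = (i, j)" and b: "binom_coeff 1 i (- l - 1 - j) (- n - 1) \<noteq> 0"
      and F: "F (- i - 1) (- j - 1) \<noteq> 0" by auto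
    have i: "i = - l - 1 - j - n - 1" and c: "(of_int i gchoose e :: complex) \<noteq> 0"
      using b by (auto simp: binom_coeff_def e_def split: if_splits)
    have "- j - 1 = l + n - (- i - 1)" using i by simp
    with c F have "T (- i - 1) \<noteq> 0" by (simp add: T_def)
    moreover have "x = \<phi> (- i - 1)" using i x by (simp add: \<phi>_def)
    ultimately show "x \<in> \<phi> ` {p. T p \<noteq> 0}" by blast
  next
    fix x assume "x \<in> \<phi> ` {p. T p \<noteq> 0}"
    then obtain p where x: "x = \<phi> p" and T: "T p \<noteq> 0" by blast
    have "- (- (l + n - p) - 1) - 1 = l + n - p" "- (- p - 1) - 1 = p" by simp_all
    then show "x \<in> {(i, j). binom_coeff 1 i (- l - 1 - j) (- n - 1) \<noteq> 0 \<and> F (- i - 1) (- j - 1) \<noteq> 0}"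
      using T False by (auto simp: x \<phi>_def T_def binom_coeff_def e_def)
  qed
  have "subst_coeff scale (\<lambda>i j. F (- i - 1) (- j - 1)) (- l - 1) (- n - 1) = (\<Sum>p | T p \<noteq> 0. T p)"
    unfolding subst_coeff_def set
    by (subst sum.reindex) (use False in \<open>auto simp: inj_on_def \<phi>_def T_def binom_coeff_def e_def intro!: sum.cong\<close>)
  also have "\<dots> = (\<Sum>p\<in>{n - int B<..n} \<union> ({n<..<0} \<union> {0..<int B}). T p)"
  proof (rule sum.mono_neutral_left)
    show "{p. T p \<noteq> 0} \<subseteq> {n - int B<..n} \<union> ({n<..<0} \<union> {0..<int B})"
    proof
      fix p assume "p \<in> {p. T p \<noteq> 0}"
      then have "F p (l + n - p) \<noteq> 0" by (auto simp: T_def)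
      then have "p < N" "l + n - p < N" using left right not_less by blast+
      then show "p \<in> {n - int B<..n} \<union> ({n<..<0} \<union> {0..<int B})"
        unfolding B_def by auto
    qed
  qed auto
  also have "\<dots> = (\<Sum>p\<in>{n - int B<..n}. T p) + ((\<Sum>p\<in>{n<..<0}. T p) + (\<Sum>p\<in>{0..<int B}. T p))"
    using False by (subst sum.union_disjoint, auto)+
  also have "(\<Sum>p\<in>{n<..<0}. T p) = 0"
  proof (rule sum.neutral, intro ballI)
    fix p assume "p \<in> {n<..<0}"
    then have "(of_int (- p - 1) :: complex) = of_nat (nat (- p - 1))" "nat (- p - 1) < e"
      by (auto simp: e_def)
    then show "T p = 0" by (simp add: T_def flip: binomial_gbinomial del: of_int_diff of_int_minus)
  qed
  also have "(\<Sum>p\<in>{n - int B<..n}. T p) = binomial_sum F 0 n l"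
  proof -
    have "binomial_sum F 0 n l = (\<Sum>j<B. T (n - int j))"
    proof (subst binomial_sum_lessThan[where Q = N and B = B])
      show "(\<Sum>j<B. alt_binomial n j \<cdot> F (0 + n - int j) (l + int j)) = (\<Sum>j<B. T (n - int j))"
      proof (intro sum.cong refl)
        fix j
        have "(alt_binomial n j :: complex) = of_nat (j + e) gchoose j"
          by (simp add: alt_binomial_eq n)
        also have "\<dots> = of_nat (j + e) gchoose e"
          using gbinomial_of_nat_symmetric[of j "j + e"] by simp
        finally show "alt_binomial n j \<cdot> F (0 + n - int j) (l + int j) = T (n - int j)"
          by (simp add: T_def n algebra_simps)
      qed
    qed (use right in \<open>auto simp: B_def\<close>)
    also have "\<dots> = (\<Sum>p\<in>{n - int B<..n}. T p)"
      by (rule sum.reindex_bij_witness[of _ "\<lambda>p. nat (n - p)" "\<lambda>j. n - int j"]) auto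
    finally show ?thesis ..
  qed
  also have "(\<Sum>p\<in>{0..<int B}. T p) = - ((- 1) powi n \<cdot> binomial_sum (\<lambda>q p. F p q) l n 0)"
  proof -
    have "- ((- 1) powi n \<cdot> binomial_sum (\<lambda>q p. F p q) l n 0) = (\<Sum>j<B. T (int j))"
    proof (subst binomial_sum_lessThan[where Q = N and B = B])
      show "- ((- 1) powi n \<cdot> (\<Sum>j<B. alt_binomial n j \<cdot> F (0 + int j) (l + n - int j))) = (\<Sum>j<B. T (int j))"
        unfolding scale_sum_right sum_negf[symmetric]
      proof (intro sum.cong refl)
        fix j
        have "(alt_binomial n j :: complex) = of_nat (j + e) gchoose j"
          by (simp add: alt_binomial_eq n)
        also have "\<dots> = of_nat (j + e) gchoose e"
          using gbinomial_of_nat_symmetric[of j "j + e"] by simp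
        finally have 1: "(alt_binomial n j :: complex) = of_nat (j + e) gchoose e" .
        have 2: "(of_int (- int j - 1) gchoose e :: complex) = (- 1) ^ e * (of_nat (j + e) gchoose e)"
          by (subst gbinomial_negated_upper) (simp add: algebra_simps)
        have 3: "(- 1) powi n = (- ((- 1) ^ e) :: complex)"
          unfolding n by (cases "even e") (simp_all add: power_int_diff)
        show "- ((- 1) powi n \<cdot> alt_binomial n j \<cdot> F (0 + int j) (l + n - int j)) = T (int j)"
          unfolding T_def 1 2 3 by simp
      qed
    qed (use left in \<open>auto simp: B_def\<close>)
    also have "\<dots> = (\<Sum>p\<in>{0..<int B}. T p)"
      by (rule sum.reindex_bij_witness[of _ nat int]) auto
    finally show ?thesis ..
  qed
  finally show ?thesis by (simp add: jacobi_lhs_def)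
qed

lemma E_space_add: "a \<in> E_space scale \<Longrightarrow> a (u + v) k = a u k + a v k"
  by (simp add: E_space_def Hom_on_def)

lemma E_space_scale: "a \<in> E_space scale \<Longrightarrow> a (c \<cdot> u) k = c \<cdot> a u k"
  by (simp add: E_space_def Hom_on_def pointwise_def)

lemma E_space_bound:
  assumes "a \<in> E_space scale"
  obtains N where "\<And>n p. N \<le> n \<Longrightarrow> component a p n w = 0"
proof -
  have "a w \<in> laurent UNIV" using assms by (simp add: E_space_def Hom_on_def)
  then obtain N where N: "\<And>n m. n < N \<Longrightarrow> a w (n, m) = 0" unfolding laurent_def by blast
  show thesis by (rule that[of "- N"]) (auto simp: component_def intro!: N)
qed

lemma field_component:
  assumes a: "a \<in> E_space scale"
  shows "formal_field (component a p)"
proof (rule fieldI)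
  show "\<exists>N. \<forall>n\<ge>N. component a p n w = 0" for w
    using E_space_bound[OF a, of w] by metis
qed (simp_all add: component_def E_space_add[OF a] E_space_scale[OF a])

lemma diff_power_mult_prod_xy:
  "diff_power_mult scale k (prod_xy a b w) (i, j, m, n)
    = difference_mult (\<lambda>p q. component a m p (component b n q w)) k (- i - 1) (- j - 1)"
  unfolding diff_power_mult_eq by (simp add: prod_xy_def component_def)

lemma diff_power_mult_prod_yx:
  "diff_power_mult scale k (prod_yx a b w) (i, j, m, n)
    = difference_mult (\<lambda>p q. component b n q (component a m p w)) k (- i - 1) (- j - 1)"
  unfolding diff_power_mult_eq by (simp add: prod_yx_def component_def)

lemma mutually_localE:
  assumes "mutually_local scale a b"
  obtains K where "\<And>w p q m n.
    difference_mult (\<lambda>p q. component a m p (component b n q w)) K p q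
    = difference_mult (\<lambda>p q. component b n q (component a m p w)) K p q"
proof -
  obtain K where K: "\<And>w. diff_power_mult scale K (prod_xy a b w) = diff_power_mult scale K (prod_yx a b w)"
    using assms unfolding mutually_local_def by blast
  show thesis
  proof (rule that[of K])
    fix w p q m n
    show "difference_mult (\<lambda>p q. component a m p (component b n q w)) K p q
      = difference_mult (\<lambda>p q. component b n q (component a m p w)) K p q"
      using fun_cong[OF K[of w], of "(- p - 1, - q - 1, m, n)"]
      by (simp add: diff_power_mult_prod_xy diff_power_mult_prod_yx)
  qed
qed

lemma local_fields_component:
  assumes "mutually_local scale a b"
  shows "local_fields (component a m) (component b n)"
  using mutually_localE[OF assms] unfolding local_fields_def difference_mult_diff
  by (metis eq_iff_diff_eq_0)

lemma difference_mult_add_fun: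
  "difference_mult (\<lambda>p q. D p q + E p q) n p q = difference_mult D n p q + difference_mult E n p q"
  by (induction n arbitrary: p q) (auto simp: algebra_simps)

lemma difference_mult_scale:
  "difference_mult (\<lambda>p q. c \<cdot> D p q) n p q = c \<cdot> difference_mult D n p q"
  by (induction n arbitrary: p q) (auto simp: algebra_simps)

text \<open>Both orders of the product agree after multiplication by \<open>(x\<^sub>0 - y\<^sub>0)\<^sup>K\<close>.  One of them has bounded
  powers of \<open>x\<^sub>0\<close> and the other one has bounded powers of \<open>y\<^sub>0\<close>.\<close>

lemma compatible_order_exists:
  assumes a: "a \<in> E_space scale" and b: "b \<in> E_space scale" and loc: "mutually_local scale a b"
  shows "\<exists>k. compatible_order scale a b k"
proof -
  obtain K where K: "\<And>w p q m n.
    difference_mult (\<lambda>p q. component a m p (component b n q w)) K p q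
    = difference_mult (\<lambda>p q. component b n q (component a m p w)) K p q"
    using mutually_localE[OF loc] by blast
  note fa = field_component[OF a] and fb = field_component[OF b]
  have "diff_power_mult scale K (prod_xy a b w) \<in> laurent2" for w
  proof -
    obtain P where P: "\<And>n p. P \<le> n \<Longrightarrow> component a p n w = 0" using E_space_bound[OF a] by blast
    obtain Q where Q: "\<And>n p. Q \<le> n \<Longrightarrow> component b p n w = 0" using E_space_bound[OF b] by blast
    have "diff_power_mult scale K (prod_xy a b w) (i, j, m, n) = 0"
      if "i < - max P Q \<or> j < - max P Q" for i j m n
      using that
    proof
      assume "i < - max P Q"
      then have "P \<le> - i - 1" by simp
      then show ?thesis unfolding diff_power_mult_prod_xy K
        by (intro difference_mult_vanish_left[where P = P]) (auto simp: P fb)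
    next
      assume "j < - max P Q"
      then have "Q \<le> - j - 1" by simp
      then show ?thesis unfolding diff_power_mult_prod_xy
        by (intro difference_mult_vanish_right[where Q = Q]) (auto simp: Q fa)
    qed
    then show ?thesis unfolding laurent2_def by blast
  qed
  then have "compatible_order scale a b K"
    unfolding compatible_order_def Hom_on_def
    by (auto simp: fun_eq_iff pointwise_def diff_power_mult_prod_xy field_add[OF fa] field_add[OF fb]
        field_scale[OF fa] field_scale[OF fb] difference_mult_add_fun difference_mult_scale)
  then show ?thesis ..
qed

text \<open>A factor \<open>(x - y)\<^sup>k\<close> can be moved from the binomials to both series at once.\<close>

lemma jacobi_lhs_difference_mult:
  assumes X: "\<And>p q. Q \<le> q \<Longrightarrow> X p q = 0" and Y: "\<And>p q. P \<le> p \<Longrightarrow> Y p q = 0"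
  shows "jacobi_lhs X (\<lambda>q p. Y p q) m (n + int k) l
    = jacobi_lhs (difference_mult X k) (\<lambda>q p. difference_mult Y k p q) m n l"
proof -
  have 1: "binomial_sum X m (n + int k) l = binomial_sum (difference_mult X k) m n l"
    by (rule binomial_sum_shift[OF X])
  have "binomial_sum (\<lambda>q p. Y p q) l (n + int k) m = binomial_sum (difference_mult (\<lambda>q p. Y p q) k) l n m"
    by (rule binomial_sum_shift[where Q = P, OF Y])
  also have "difference_mult (\<lambda>q p. Y p q) k = (\<lambda>q p. (- 1) ^ k \<cdot> difference_mult Y k p q)"
    by (intro ext, subst difference_mult_flip) simp
  also have "binomial_sum (\<lambda>q p. (- 1) ^ k \<cdot> difference_mult Y k p q) l n m
    = (- 1) ^ k \<cdot> binomial_sum (\<lambda>q p. difference_mult Y k p q) l n m"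
    by (subst (1 2) binomial_sum_lessThan[where Q = P, OF _ order_refl])
      (auto simp: difference_mult_vanish_left[where D = Y, OF Y] scale_sum_right mult.commute)
  finally have 2: "binomial_sum (\<lambda>q p. Y p q) l (n + int k) m
    = (- 1) ^ k \<cdot> binomial_sum (\<lambda>q p. difference_mult Y k p q) l n m" .
  have "(- 1) powi (n + int k) * (- 1) ^ k = ((- 1) powi n :: complex)"
    by (simp add: power_int_add flip: power_mult_distrib)
  then show ?thesis unfolding jacobi_lhs_def 1 2 by simp
qed

text \<open>The order \<open>k\<close> that was chosen in the definition of \<open>Y\<^sub>\<E>\<close> only guarantees that \<open>(x\<^sub>0 - y\<^sub>0)\<^sup>k a b\<close>
  has bounded powers.  By locality and cancellation, \<open>(x\<^sub>0 - y\<^sub>0)\<^sup>k b a\<close> is the same series, and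
  \<open>residue_substitution\<close> applies.\<close>

theorem component_Y_E:
  assumes a: "a \<in> E_space scale" and b: "b \<in> E_space scale" and loc: "mutually_local scale a b"
  shows "component (Y_E scale a b (- n - 1, p)) q
    = nth_product n (component a p) (component b (q - p))"
proof (intro ext)
  fix l w
  define k where "k = (SOME k. compatible_order scale a b k)"
  define f where "f = component a p"
  define g where "g = component b (q - p)"
  define A where "A = (\<lambda>p' q'. f p' (g q' w))"
  define B where "B = (\<lambda>p' q'. g q' (f p' w))"
  define F where "F = difference_mult A k"
  have f: "formal_field f" and g: "formal_field g" by (simp_all add: f_def g_def field_component a b)
  have "compatible_order scale a b k"
    unfolding k_def by (rule someI_ex[OF compatible_order_exists[OF assms]])
  then have "diff_power_mult scale k (prod_xy a b w) \<in> laurent2"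
    by (simp add: compatible_order_def Hom_on_def)
  then obtain N where N: "\<And>i j m n. i < N \<or> j < N \<Longrightarrow> diff_power_mult scale k (prod_xy a b w) (i, j, m, n) = 0"
    unfolding laurent2_def by blast
  have F: "F p' q' = 0" if "- N \<le> p' \<or> - N \<le> q'" for p' q'
    using N[of "- p' - 1" "- q' - 1" p "q - p"] that
    by (auto simp: diff_power_mult_prod_xy F_def A_def f_def g_def)
  obtain P where P: "\<And>n. P \<le> n \<Longrightarrow> f n w = 0" using field_bound[OF f] by blast
  obtain Q where Q: "\<And>n. Q \<le> n \<Longrightarrow> g n w = 0" using field_bound[OF g] by blast
  obtain K where K: "\<And>p' q'. difference_mult (\<lambda>p' q'. A p' q' - B p' q') K p' q' = 0"
    using local_fields_component[OF loc, of p "q - p"]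
    unfolding local_fields_def A_def B_def f_def g_def by blast
  have BF: "difference_mult B k = F"
  proof (intro ext)
    fix p' q'
    define D where "D = (\<lambda>p q. A p q - B p q)"
    have "difference_mult D k p' q' = 0"
    proof (rule difference_mult_cancel[where n = K and P = "max (- N) P"])
      show "difference_mult (difference_mult D k) K p q = 0" for p q
        unfolding difference_mult_add by (rule difference_mult_mono[of D K]) (use K in \<open>auto simp: D_def\<close>)
      show "difference_mult D k p q = 0" if "max (- N) P \<le> p" for p q
      proof -
        have "difference_mult B k p q = 0"
          by (rule difference_mult_vanish_left[where P = P]) (use that P g in \<open>auto simp: B_def\<close>)
        then show ?thesis using F that by (simp add: D_def difference_mult_diff F_def)
      qed
    qed
    then show "difference_mult B k p' q' = F p' q'" by (simp add: D_def difference_mult_diff F_def)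
  qed
  have "component (Y_E scale a b (- n - 1, p)) q l w
    = subst_coeff scale (\<lambda>i j. F (- i - 1) (- j - 1)) (- l - 1) (- (n - int k) - 1)"
  proof -
    have "- (n - int k) - 1 = - n - 1 + int k" by simp
    then show ?thesis
      unfolding component_def[of "Y_E scale a b (- n - 1, p)"]
      by (simp only:) (simp add: Y_E_def Y_E_order_def k_def[symmetric] diff_power_mult_prod_xy F_def A_def
        f_def g_def)
  qed
  also have "\<dots> = jacobi_lhs F (\<lambda>q p. F p q) 0 (n - int k) l"
    by (rule residue_substitution[where N = "- N"]) (use F in auto)
  also have "\<dots> = jacobi_lhs A (\<lambda>q p. B p q) 0 (n - int k + int k) l"
    unfolding BF[symmetric] F_def
    by (subst jacobi_lhs_difference_mult[where P = P and Q = Q])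
      (use P Q f g BF in \<open>auto simp: A_def B_def F_def\<close>)
  also have "\<dots> = nth_product n f g l w"
    by (simp add: nth_product_def A_def B_def)
  finally show "component (Y_E scale a b (- n - 1, p)) q l w
    = nth_product n (component a p) (component b (q - p)) l w"
    by (simp add: f_def g_def)
qed

lemma subst_coeff_negative: "e < 0 \<Longrightarrow> subst_coeff scale G d e = 0"
  by (simp add: subst_coeff_def binom_coeff_def)

lemma Y_E_bound: "\<exists>N. \<forall>n m. n < N \<longrightarrow> Y_E scale a b (n, m) = 0"
proof (intro exI allI impI)
  fix n m assume "n < - int (SOME k. compatible_order scale a b k)"
  then show "Y_E scale a b (n, m) = 0"
    by (simp add: Y_E_def Y_E_order_def subst_coeff_negative fun_eq_iff)
qed

lemma const_series_E_space: "(const_series :: ('r::finite, 'w) opseries) \<in> E_space scale"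
proof -
  have "(const_series u :: ('r, 'w) series) \<in> laurent UNIV" for u
    unfolding laurent_def const_series_def by (auto intro!: exI[of _ 0])
  then show ?thesis
    by (simp add: E_space_def Hom_on_def const_series_def pointwise_def fun_eq_iff)
qed

lemma component_const_series: "component const_series p n w = (if n = - 1 \<and> p = 0 then w else 0)"
  by (auto simp: component_def const_series_def)

lemma nth_product_vacuum_left:
  assumes g: "formal_field g"
  shows "nth_product n (component const_series p) g k w = (if n = - 1 \<and> p = 0 then g k w else 0)"
proof (cases "p = 0")
  case True
  obtain Q where Q: "\<And>n. Q \<le> n \<Longrightarrow> g n w = 0" using field_bound[OF g] by blast
  have "(\<Sum>j<B. alt_binomial n j \<cdot> component const_series p (n - int j) (g (k + int j) w))
    = (if n = - 1 then g k w else 0)" if "0 < B" for B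
  proof -
    have "alt_binomial n j \<cdot> component const_series p (n - int j) (g (k + int j) w)
      = (if j = 0 \<and> n = - 1 then g k w else 0)" for j
    proof (cases "n - int j = - 1 \<and> 0 < j")
      case True
      then obtain i where j: "j = Suc i" by (cases j) auto
      have n: "n = int i" using True j by simp
      show ?thesis unfolding n j by (simp add: alt_binomial_nat)
    qed (auto simp: component_const_series True)
    then show ?thesis using that by (simp add: sum.If_cases)
  qed
  then have part: "partial_product B n (component const_series p) g k w = (if n = - 1 then g k w else 0)"
    if "0 < B" for B
    using that g by (simp add: partial_product_def component_const_series)
  have "\<forall>\<^sub>F B in sequentially. nth_product n (component const_series p) g k w
      = partial_product B n (component const_series p) g k w"
    by (rule eventually_partial_product[OF field_component[OF const_series_E_space] g])
  then have "\<forall>\<^sub>F B::nat in sequentially. nth_product n (component const_series p) g k w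
      = (if n = - 1 then g k w else 0)"
    using eventually_gt_at_top[of 0] by eventually_elim (simp add: part)
  then show ?thesis using True by simp
next
  case False
  then have zero: "component const_series p = (\<lambda>n w. 0)"
    by (simp add: fun_eq_iff component_const_series)
  show ?thesis unfolding zero using False nth_product_zero_left[OF g] by simp
qed

text \<open>The identity field commutes with every field.\<close>

lemma nth_product_vacuum_right:
  assumes f: "formal_field f" and n: "0 \<le> n"
  shows "nth_product n f (component const_series p) k w = 0"
proof -
  obtain P where P: "\<And>n. P \<le> n \<Longrightarrow> f n w = 0" using field_bound[OF f] by blast
  have "nth_product (int (nat n)) f (component const_series p) k w = 0"
    unfolding nth_product_def
    by (subst jacobi_lhs_of_nat[where Q = 0 and P = P])
      (auto simp: P f component_const_series difference_mult_zero if_distrib[of "f _"] cong: if_cong)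
  then show ?thesis using n by simp
qed

lemma component_add: "component (a + b) p = (\<lambda>n w. component a p n w + component b p n w)"
  by (simp add: component_def fun_eq_iff)

lemma component_E_scale: "component (E_scale scale c a) p = (\<lambda>n w. c \<cdot> component a p n w)"
  by (simp add: component_def fun_eq_iff E_scale_def pointwise_def)

lemma component_E_D0: "component (E_D0 scale a) p = derivative (component a p)"
  by (simp add: component_def[abs_def] fun_eq_iff E_D0_def d_x0_def derivative_def)

lemma component_E_D: "component (E_D scale i a) p = (\<lambda>n w. of_int (p $ i) \<cdot> component a p n w)"
  by (simp add: component_def fun_eq_iff E_D_def x_d_x_def)

lemma vector_space_E_scale: "vector_space (E_scale scale)"
  by unfold_locales (auto simp: E_scale_def pointwise_def fun_eq_iff algebra_simps)

end

section \<open>Closed local spaces of toroidal fields\<close>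

locale closed_local_space = complex_vector_space scale
  for scale :: "complex \<Rightarrow> 'w::ab_group_add \<Rightarrow> 'w" (infixr \<open>\<cdot>\<close> 75) +
  fixes V :: "('r::finite, 'w) opseries set"
  assumes V_E_space: "V \<subseteq> E_space scale"
    and subspace_V: "module.subspace (E_scale scale) V"
    and local_V: "local_set scale V"
    and closed_V: "closed_set scale V"
    and one_V: "const_series \<in> V"
begin

sublocale E: complex_vector_space "E_scale scale :: complex \<Rightarrow> ('r, 'w) opseries \<Rightarrow> ('r, 'w) opseries"
  by (simp add: complex_vector_space_def char0_vector_space_def vector_space_E_scale)

lemma E_space_V: "a \<in> V \<Longrightarrow> a \<in> E_space scale"
  using V_E_space by blast

lemma field_V: "a \<in> V \<Longrightarrow> formal_field (component a p)"
  by (simp add: E_space_V field_component)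

lemma V_local: "a \<in> V \<Longrightarrow> b \<in> V \<Longrightarrow> mutually_local scale a b"
  using local_V by (simp add: local_set_def)

lemma fields_V_local: "a \<in> V \<Longrightarrow> b \<in> V \<Longrightarrow> local_fields (component a p) (component b q)"
  by (simp add: V_local local_fields_component)

lemma component_Y_E_V:
  "a \<in> V \<Longrightarrow> b \<in> V \<Longrightarrow> component (Y_E scale a b (d, p)) q
    = nth_product (- d - 1) (component a p) (component b (q - p))"
  using component_Y_E[OF E_space_V E_space_V V_local, of a b "- d - 1"] by simp

lemma Y_E_apply:
  "a \<in> V \<Longrightarrow> b \<in> V \<Longrightarrow> Y_E scale a b (d, p) w (e, q)
    = nth_product (- d - 1) (component a p) (component b (q - p)) (- e - 1) w"
  using component_Y_E_V[of a b d p q] by (simp add: opseries_component)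

lemma Y_E_in_V: "a \<in> V \<Longrightarrow> b \<in> V \<Longrightarrow> Y_E scale a b k \<in> V"
proof -
  assume "a \<in> V" "b \<in> V"
  then have "mode (Y_E scale a b) (- fst k - 1) (- snd k) \<in> V"
    using closed_V by (simp add: closed_set_def)
  then show "Y_E scale a b k \<in> V" by (simp add: mode_def)
qed

lemma add_V: "a \<in> V \<Longrightarrow> b \<in> V \<Longrightarrow> a + b \<in> V"
  using subspace_V E.subspace_add by blast

lemma scale_V: "a \<in> V \<Longrightarrow> E_scale scale c a \<in> V"
  using subspace_V E.subspace_scale by blast

lemma Y_E_eqI:
  assumes "\<And>d p q l w. component (F (d, p)) q l w = component (G (d, p)) q l w"
  shows "F = (G :: ('r, ('r, 'w) opseries) series)"
  using assms by (auto simp: fun_eq_iff opseries_component)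

lemma Y_E_laurent: "a \<in> V \<Longrightarrow> b \<in> V \<Longrightarrow> Y_E scale a b \<in> laurent V"
  using Y_E_bound[of a b] unfolding laurent_def by (auto intro: Y_E_in_V)

lemma Y_E_add_left:
  "a \<in> V \<Longrightarrow> b \<in> V \<Longrightarrow> c \<in> V \<Longrightarrow> Y_E scale (a + b) c = Y_E scale a c + Y_E scale b c"
  by (rule Y_E_eqI) (simp add: component_Y_E_V add_V component_add nth_product_add_left field_V)

lemma Y_E_add_right:
  "a \<in> V \<Longrightarrow> b \<in> V \<Longrightarrow> c \<in> V \<Longrightarrow> Y_E scale a (b + c) = Y_E scale a b + Y_E scale a c"
  by (rule Y_E_eqI) (simp add: component_Y_E_V add_V component_add nth_product_add_right field_V)

lemma Y_E_scale_left:
  "a \<in> V \<Longrightarrow> b \<in> V \<Longrightarrow> Y_E scale (E_scale scale c a) b = pointwise (E_scale scale) c (Y_E scale a b)"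
  by (rule Y_E_eqI)
    (simp add: pointwise_def component_Y_E_V scale_V component_E_scale nth_product_scale_left field_V)

lemma Y_E_scale_right:
  "a \<in> V \<Longrightarrow> b \<in> V \<Longrightarrow> Y_E scale a (E_scale scale c b) = pointwise (E_scale scale) c (Y_E scale a b)"
  by (rule Y_E_eqI)
    (simp add: pointwise_def component_Y_E_V scale_V component_E_scale nth_product_scale_right field_V)

lemma vertex_map_Y_E: "vertex_map (E_scale scale) V (E_scale scale) V (Y_E scale)"
  unfolding vertex_map_def Hom_on_def
  by (auto simp: Y_E_laurent Y_E_add_left Y_E_add_right Y_E_scale_left Y_E_scale_right)

lemma Y_E_vacuum_left: "a \<in> V \<Longrightarrow> Y_E scale const_series a = const_series a"
  by (rule Y_E_eqI)
    (auto simp: component_Y_E_V one_V nth_product_vacuum_left field_V const_series_def component_def)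

lemma Y_E_vacuum_right: "a \<in> V \<Longrightarrow> Y_E scale a const_series \<in> taylor V"
  unfolding taylor_def
proof (intro CollectI conjI allI impI)
  fix n :: int and m :: "int ^ 'r"
  assume a: "a \<in> V" and n: "n < 0"
  show "Y_E scale a const_series (n, m) = 0"
    by (rule opseries_eqI)
      (use n in \<open>simp add: component_Y_E_V[OF a one_V] nth_product_vacuum_right field_V[OF a] component_def[of 0]\<close>)
qed (auto intro: Y_E_in_V one_V)

text \<open>The coefficients of the Jacobi identity on \<open>W\<close> are Borcherds identities for the fields
  \<open>u\<^sup>p\<close> and \<open>v\<^sup>q\<^sup>-\<^sup>p\<close>.\<close>

lemma jacobi_W: "jacobi V (Y_E scale) scale UNIV (\<lambda>a. a)"
proof (rule jacobiI)
  fix u v w m n k and p q :: "int ^ 'r"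
  assume "u \<in> V" "v \<in> V"
  then show "jacobi_lhs (\<lambda>i j. u (v w (- j - 1, q - p)) (- i - 1, p))
      (\<lambda>j i. v (u w (- i - 1, p)) (- j - 1, q - p)) m n k =
    jacobi_rhs (\<lambda>i j. Y_E scale u v (- i - 1, p) w (- j - 1, q)) m n k"
    using borcherds_identity[OF field_V field_V fields_V_local, of u v p "q - p" w m n k]
    by (simp add: Y_E_apply component_def[of u] component_def[of v])
qed

lemma Sum_any_apply:
  fixes F :: "nat \<Rightarrow> ('r, 'w) opseries"
  assumes "\<And>j. B \<le> j \<Longrightarrow> F j = 0"
  shows "Sum_any F w x = Sum_any (\<lambda>j. F j w x)"
proof -
  have "(\<Sum>j\<in>A. F j) w x = (\<Sum>j\<in>A. F j w x)" for A
    by (induction A rule: infinite_finite_induct) auto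
  moreover have "Sum_any F = sum F {..<B}" by (rule Sum_any_lessThan) (use assms in simp)
  moreover have "Sum_any (\<lambda>j. F j w x) = (\<Sum>j<B. F j w x)"
    by (rule Sum_any_lessThan) (use assms in simp)
  ultimately show ?thesis by simp
qed

lemma E_scale_apply: "E_scale scale c a w x = c \<cdot> a w x"
  by (simp add: E_scale_def pointwise_def)

lemma binomial_sum_apply:
  assumes "\<And>p q. Q \<le> q \<Longrightarrow> X p q = 0"
  shows "E.binomial_sum X m n k w x = binomial_sum (\<lambda>p q. X p q w x) m n k"
proof -
  have "Sum_any (\<lambda>j. E_scale scale (alt_binomial n j) (X (m + n - int j) (k + int j))) w x
    = Sum_any (\<lambda>j. E_scale scale (alt_binomial n j) (X (m + n - int j) (k + int j)) w x)"
    by (rule Sum_any_apply[where B = "nat (Q - k)"]) (use assms in simp)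
  then show ?thesis by (simp add: E.binomial_sum_def binomial_sum_def E_scale_apply)
qed

lemma jacobi_rhs_apply:
  assumes "\<And>p q. N \<le> p \<Longrightarrow> Z p q = 0"
  shows "E.jacobi_rhs Z m n k w x = jacobi_rhs (\<lambda>p q. Z p q w x) m n k"
proof -
  have "Sum_any (\<lambda>j. E_scale scale (of_int m gchoose j) (Z (n + int j) (m + k - int j))) w x
    = Sum_any (\<lambda>j. E_scale scale (of_int m gchoose j) (Z (n + int j) (m + k - int j)) w x)"
    by (rule Sum_any_apply[where B = "nat (N - n)"]) (use assms in simp)
  then show ?thesis by (simp add: E.jacobi_rhs_def jacobi_rhs_def E_scale_apply)
qed

lemma Y_E_zero_right: "a \<in> V \<Longrightarrow> Y_E scale a 0 = 0"
  using Y_E_scale_right[of a const_series 0] one_V by (simp add: fun_eq_iff pointwise_def)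

lemma Y_E_zero_left: "a \<in> V \<Longrightarrow> Y_E scale 0 a = 0"
  using Y_E_scale_left[of const_series a 0] one_V by (simp add: fun_eq_iff pointwise_def)

text \<open>At the exponents \<open>p\<close>, \<open>q\<close> the component of index \<open>s\<close> of the Jacobi identity is the Borcherds
  identity for the products of \<open>u\<^sup>p\<close>, \<open>v\<^sup>q\<^sup>-\<^sup>p\<close> and \<open>h\<^sup>s\<^sup>-\<^sup>q\<close>.  The products of \<open>u\<^sup>p\<close> and \<open>v\<^sup>q\<^sup>-\<^sup>p\<close> are components
  of elements of \<open>V\<close>, hence local to the components of \<open>h\<close>.\<close>

lemma jacobi_Y_E: "jacobi V (Y_E scale) (E_scale scale) V (Y_E scale)"
proof (rule E.jacobiI)
  fix u v h m n k and p q :: "int ^ 'r"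
  assume u: "u \<in> V" and v: "v \<in> V" and h: "h \<in> V"
  let ?X = "\<lambda>i j. Y_E scale u (Y_E scale v h (- j - 1, q - p)) (- i - 1, p)"
  let ?Y = "\<lambda>j i. Y_E scale v (Y_E scale u h (- i - 1, p)) (- j - 1, q - p)"
  let ?Z = "\<lambda>i j. Y_E scale (Y_E scale u v (- i - 1, p)) h (- j - 1, q)"
  obtain Q where "\<And>n m. n < Q \<Longrightarrow> Y_E scale v h (n, m) = 0" using Y_E_bound[of v h] by blast
  then have X: "?X i j = 0" if "- Q \<le> j" for i j
    using that by (simp add: Y_E_zero_right[OF u])
  obtain P where "\<And>n m. n < P \<Longrightarrow> Y_E scale u h (n, m) = 0" using Y_E_bound[of u h] by blast
  then have Y: "?Y j i = 0" if "- P \<le> i" for i j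
    using that by (simp add: Y_E_zero_right[OF v])
  obtain R where "\<And>n m. n < R \<Longrightarrow> Y_E scale u v (n, m) = 0" using Y_E_bound[of u v] by blast
  then have Z: "?Z i j = 0" if "- R \<le> i" for i j
    using that by (simp add: Y_E_zero_left[OF h])
  note Y_V = Y_E_in_V u v h
  show "E.jacobi_lhs ?X ?Y m n k = E.jacobi_rhs ?Z m n k"
  proof (rule opseries_eqI)
    fix s l w
    define f where "f = component u p"
    define g where "g = component v (q - p)"
    define e where "e = component h (s - q)"
    note defs = f_def g_def e_def
    have loc: "local_fields (nth_product i f g) e" for i
    proof -
      have "nth_product i f g = component (Y_E scale u v (- i - 1, p)) q"
        by (simp add: component_Y_E_V u v defs)
      then show ?thesis by (simp add: e_def fields_V_local Y_V)
    qed
    have "component (E.jacobi_lhs ?X ?Y m n k) s l w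
      = jacobi_lhs (\<lambda>i j. component (?X i j) s l w) (\<lambda>j i. component (?Y j i) s l w) m n k"
      unfolding E.jacobi_lhs_def jacobi_lhs_def component_def
      by (simp add: E_scale_apply binomial_sum_apply[where Q = "- Q" and X = ?X, OF X]
          binomial_sum_apply[where Q = "- P" and X = ?Y, OF Y])
    also have "\<dots> = jacobi_lhs (\<lambda>i j. nth_product i f (nth_product j g e) l w)
        (\<lambda>j i. nth_product j g (nth_product i f e) l w) m n k"
      by (simp add: component_Y_E_V Y_V defs)
    also have "\<dots> = jacobi_rhs (\<lambda>i j. nth_product j (nth_product i f g) e l w) m n k"
      by (rule borcherds_identity_products[symmetric])
        (use loc in \<open>auto simp: defs field_V fields_V_local u v h\<close>)
    also have "\<dots> = jacobi_rhs (\<lambda>i j. component (?Z i j) s l w) m n k"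
      by (simp add: component_Y_E_V Y_V defs)
    also have "\<dots> = component (E.jacobi_rhs ?Z m n k) s l w"
      unfolding component_def
      by (rule jacobi_rhs_apply[where N = "- R" and Z = ?Z, OF Z, symmetric])
    finally show "component (E.jacobi_lhs ?X ?Y m n k) s l w = component (E.jacobi_rhs ?Z m n k) s l w" .
  qed
qed

theorem toroidal_vertex_algebra_V:
  "toroidal_vertex_algebra (E_scale scale) V (Y_E scale) const_series"
  by unfold_locales
    (simp_all add: subspace_V one_V vertex_map_Y_E Y_E_vacuum_left Y_E_vacuum_right jacobi_Y_E)

theorem faithful_module_V:
  "faithful_toroidal_module (E_scale scale) V (Y_E scale) const_series scale UNIV (\<lambda>a. a)"
proof -
  interpret toroidal_vertex_algebra "E_scale scale" V "Y_E scale" const_series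
    by (rule toroidal_vertex_algebra_V)
  have E: "a \<in> Hom_on scale UNIV (pointwise scale) (laurent UNIV)" if "a \<in> V" for a
    using E_space_V[OF that] by (simp add: E_space_def)
  have "vertex_map (E_scale scale) V scale UNIV (\<lambda>a. a)"
    unfolding vertex_map_def using E
    by (auto simp: Hom_on_def E_scale_def pointwise_def fun_eq_iff)
  then show ?thesis
    by unfold_locales (auto simp: jacobi_W inj_on_def restrict_def)
qed

text \<open>On components, \<open>D\<^sub>0\<close> is the derivative of fields in one variable, a derivation of all products, and
  \<open>D\<^sub>i\<close> multiplies the component of index \<open>p\<close> by \<open>p\<^sub>i\<close>, which is a derivation since the indices of
  the factors of a product add up.\<close>

theorem extended_toroidal_vertex_algebra_V:
  assumes D0: "\<And>a. a \<in> V \<Longrightarrow> E_D0 scale a \<in> V" and D: "\<And>i a. a \<in> V \<Longrightarrow> E_D scale i a \<in> V"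
  shows "extended_toroidal_vertex_algebra (E_scale scale) V (Y_E scale) const_series
    (E_D0 scale) (E_D scale)"
proof -
  interpret toroidal_vertex_algebra "E_scale scale" V "Y_E scale" const_series
    by (rule toroidal_vertex_algebra_V)
  have Y_D0: "Y_E scale (E_D0 scale a) b = d_x0 (E_scale scale) (Y_E scale a b)"
    if a: "a \<in> V" and b: "b \<in> V" for a b
  proof (rule Y_E_eqI)
    fix d :: int and p q :: "int ^ 'r" and l w
    have "- of_int (- d - 1) = (of_int (d + 1) :: complex)" "- d - 1 - 1 = - (d + 1) - 1"
      by simp_all
    then show "component (Y_E scale (E_D0 scale a) b (d, p)) q l w
      = component (d_x0 (E_scale scale) (Y_E scale a b) (d, p)) q l w"
      by (simp only: d_x0_def case_prod_conv component_Y_E_V D0 a b component_E_D0 component_E_scale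
          nth_product_derivative_left field_V)
  qed
  have D0_Y: "(\<lambda>k. E_D0 scale (Y_E scale a b k)) - Y_E scale a (E_D0 scale b) = Y_E scale (E_D0 scale a) b"
    if a: "a \<in> V" and b: "b \<in> V" for a b
  proof (rule Y_E_eqI)
    fix d :: int and p q :: "int ^ 'r" and l w
    have diff: "component (x - y) q l w = component x q l w - component y q l w" for x y :: "('r, 'w) opseries"
      by (simp add: component_def)
    show "component (((\<lambda>k. E_D0 scale (Y_E scale a b k)) - Y_E scale a (E_D0 scale b)) (d, p)) q l w
      = component (Y_E scale (E_D0 scale a) b (d, p)) q l w"
      by (simp add: diff component_Y_E_V D0 a b component_E_D0 nth_product_derivative_left
        nth_product_derivative_right field_V algebra_simps)
  qed
  have Y_D: "Y_E scale (E_D scale i a) b = x_d_x (E_scale scale) i (Y_E scale a b)"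
    if a: "a \<in> V" and b: "b \<in> V" for i a b
    by (rule Y_E_eqI)
      (simp add: x_d_x_def component_Y_E_V D a b component_E_D component_E_scale
        nth_product_scale_left field_V)
  have D_Y: "(\<lambda>k. E_D scale i (Y_E scale a b k)) - Y_E scale a (E_D scale i b) = Y_E scale (E_D scale i a) b"
    if a: "a \<in> V" and b: "b \<in> V" for i a b
  proof (rule Y_E_eqI)
    fix d :: int and p q :: "int ^ 'r" and l w
    have diff: "component (x - y) q l w = component x q l w - component y q l w" for x y :: "('r, 'w) opseries"
      by (simp add: component_def)
    show "component (((\<lambda>k. E_D scale i (Y_E scale a b k)) - Y_E scale a (E_D scale i b)) (d, p)) q l w
      = component (Y_E scale (E_D scale i a) b (d, p)) q l w"
      by (simp add: diff component_Y_E_V D a b component_E_D nth_product_scale_left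
        nth_product_scale_right field_V flip: scale_left_diff_distrib)
  qed
  have "E_D0 scale \<in> Hom_on (E_scale scale) V (E_scale scale) V"
    "E_D scale i \<in> Hom_on (E_scale scale) V (E_scale scale) V" for i
  proof -
    have "E_D0 scale (a + b) = E_D0 scale a + E_D0 scale b"
      "E_D scale i (a + b) = E_D scale i a + E_D scale i b"
      "E_D0 scale (E_scale scale c a) = E_scale scale c (E_D0 scale a)"
      "E_D scale i (E_scale scale c a) = E_scale scale c (E_D scale i a)"
      for a b :: "('r, 'w) opseries" and i c
      by (simp_all add: E_D0_def E_D_def d_x0_def x_d_x_def E_scale_def pointwise_def fun_eq_iff
          scale_right_distrib mult.commute)
    then show "E_D0 scale \<in> Hom_on (E_scale scale) V (E_scale scale) V"
      "E_D scale i \<in> Hom_on (E_scale scale) V (E_scale scale) V"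
      by (simp_all add: Hom_on_def D0 D)
  qed
  moreover have "E_D0 scale const_series = 0" "E_D scale i const_series = 0" for i
    by (auto simp: E_D0_def E_D_def d_x0_def x_d_x_def const_series_def fun_eq_iff
        simp del: of_int_add)
  ultimately show ?thesis
    by unfold_locales (auto simp: Y_D0 D0_Y Y_D D_Y)
qed

end

theorem theorem3p4:
  fixes scale :: "complex \<Rightarrow> 'w::ab_group_add \<Rightarrow> 'w"
    and V :: "('r::finite, 'w) opseries set"
  assumes "vector_space scale"
    and "V \<subseteq> E_space scale"
    and "module.subspace (E_scale scale) V"
    and "local_set scale V"
    and "closed_set scale V"
    and "const_series \<in> V"
  shows "toroidal_vertex_algebra (E_scale scale) V (Y_E scale) const_series \<and>
    faithful_toroidal_module (E_scale scale) V (Y_E scale) const_series scale UNIV (\<lambda>a. a) \<and>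
    ((\<forall>a\<in>V. E_D0 scale a \<in> V) \<and> (\<forall>i. \<forall>a\<in>V. E_D scale i a \<in> V) \<longrightarrow>
      extended_toroidal_vertex_algebra (E_scale scale) V (Y_E scale) const_series
        (E_D0 scale) (E_D scale))"
proof -
  interpret closed_local_space scale V
    using assms by (simp add: closed_local_space_def closed_local_space_axioms_def
        complex_vector_space_def char0_vector_space_def)
  show ?thesis
    using toroidal_vertex_algebra_V faithful_module_V extended_toroidal_vertex_algebra_V by blast
qed

end
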